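(* For every countable ordinal $\beta<\omega_1$, the compact space $([0,1]^\beta,\tau_\prec)$, i.e. $[0,1]^\beta$ endowed with the order topology of its lexicographic order $\prec$, is a Rosenthal compactum that is (homeomorphic to) a subspace of a Rosenthal compactum in the class $\mathcal{RK}_0$.
   Context: Lexicographic order on $[0,1]^\beta$: $x\prec y$ iff $x\neq y$ and $x_\gamma<y_\gamma$ for the first ordinal $\gamma<\beta$ at which $x_\gamma\neq y_\gamma$. A compact space $K$ is a Rosenthal compactum if it is homeomorphic to a set of functions $f:X\to\mathbb{R}$ of the first Baire class on some Polish space $X$, compact in the topology of pointwise convergence. A compact space $K$ belongs to the class $\mathcal{RK}_0$ if it is homeomorphic to a pointwise compact set $K'$ of functions $f:X\to\mathbb{R}$ of the first Baire class on some compact metric space $X$, such that $K'$ is the pointwise closure of a countable set of continuous functions on $X$. *)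

theory Defs
  imports "HOL-Analysis.Analysis"
begin

text \<open>
  An ordinal is given by a well-order \<open>r\<close> (a reflexive relation), whose field plays the role
  of the set of smaller ordinals.  The empty relation is the ordinal zero, and then the cube
  is a single point.
\<close>

definition lex_cube :: "'a rel \<Rightarrow> ('a \<Rightarrow> real) set" where
  "lex_cube r = (Field r \<rightarrow>\<^sub>E {0..1})"

definition lex_less :: "'a rel \<Rightarrow> ('a \<Rightarrow> real) \<Rightarrow> ('a \<Rightarrow> real) \<Rightarrow> bool" where
  "lex_less r x y \<longleftrightarrow> (\<exists>\<gamma>\<in>Field r. (\<forall>\<delta>\<in>underS r \<gamma>. x \<delta> = y \<delta>) \<and> x \<gamma> < y \<gamma>)"

text \<open>
  The order topology of a strict order on a carrier set has the open rays as a subbase.  The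
  carrier itself is included because a one-point order has no non-empty ray.
\<close>

definition order_topology_of :: "'a set \<Rightarrow> ('a \<Rightarrow> 'a \<Rightarrow> bool) \<Rightarrow> 'a topology" where
  "order_topology_of A lt = topology_generated_by
     (insert A ((\<lambda>a. {x \<in> A. lt x a}) ` A \<union> (\<lambda>a. {x \<in> A. lt a x}) ` A))"

lemma topspace_order_topology_of [simp]: "topspace (order_topology_of A lt) = A"
  unfolding order_topology_of_def topology_generated_by_topspace by auto

definition lex_cube_topology :: "'a rel \<Rightarrow> ('a \<Rightarrow> real) topology" where
  "lex_cube_topology r = order_topology_of (lex_cube r) (lex_less r)"

definition polish :: "'a topology \<Rightarrow> bool" where
  "polish X \<longleftrightarrow> completely_metrizable_space X \<and> separable_space X"

text \<open>
  A function on the space \<open>X\<close> is represented by its extension with the value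
  \<^term>\<open>undefined\<close> off \<^term>\<open>topspace X\<close>, so that functions on \<open>X\<close> are exactly the points of
  \<^term>\<open>powertop_real (topspace X)\<close>, whose topology is that of pointwise convergence.
\<close>

definition baire_one :: "'a topology \<Rightarrow> ('a \<Rightarrow> real) set" where
  "baire_one X = {f \<in> extensional (topspace X).
     \<exists>g :: nat \<Rightarrow> 'a \<Rightarrow> real. (\<forall>n. continuous_map X euclideanreal (g n)) \<and>
       (\<forall>x\<in>topspace X. (\<lambda>n. g n x) \<longlonglongrightarrow> f x)}"

text \<open>
  Polish spaces and compact metrizable spaces have at most the cardinality of the continuum.
  Up to homeomorphism they therefore all occur as topologies (unrelated to the usual one) on
  sets of reals, so that quantifying over \<open>X :: real topology\<close> loses no generality.
\<close>

definition rosenthal_compactum :: "'b topology \<Rightarrow> bool" where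
  "rosenthal_compactum K \<longleftrightarrow> compact_space K \<and>
     (\<exists>(X :: real topology) F. polish X \<and> F \<subseteq> baire_one X \<and>
        compactin (powertop_real (topspace X)) F \<and>
        K homeomorphic_space subtopology (powertop_real (topspace X)) F)"

definition class_RK0 :: "'b topology \<Rightarrow> bool" where
  "class_RK0 K \<longleftrightarrow> compact_space K \<and>
     (\<exists>(X :: real topology) F D. compact_space X \<and> metrizable_space X \<and> F \<subseteq> baire_one X \<and>
        compactin (powertop_real (topspace X)) F \<and>
        countable D \<and>
        D \<subseteq> {f \<in> extensional (topspace X). continuous_map X euclideanreal f} \<and>
        F = powertop_real (topspace X) closure_of D \<and>
        K homeomorphic_space subtopology (powertop_real (topspace X)) F)"

end

theory Submission
  imports Defs "HOL-Real_Asymp.Real_Asymp"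
begin

text \<open>
  Let \<open>\<beta>\<close> be the ordinal.  The points of the lexicographically ordered cube are turned into functions of a second variable \<open>s\<close>, which ranges over the same
  cube, now with its product topology; as \<open>\<beta>\<close> is countable, this is a compact metrizable
  space.  For a coordinate \<open>\<gamma>\<close> let \<open>\<phi>\<^sub>\<gamma>(s, x)\<close> be \<open>x\<^sub>\<gamma>\<close> if \<open>s\<close> and \<open>x\<close> agree
  below \<open>\<gamma>\<close>, and otherwise \<open>1\<close> or \<open>0\<close> according to whether \<open>s\<close> precedes \<open>x\<close>.  For fixed \<open>s\<close>, the
  sets where this function of \<open>x\<close> lies above or below a level are open rays,
  empty or everything, so it is continuous for the order topology.  A weighted sum \<open>f\<^sub>x(s)\<close> of the \<open>\<phi>\<^sub>\<gamma>(s, x)\<close> over all \<open>\<gamma>\<close> is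
  still continuous in \<open>x\<close>, and it separates points, since \<open>f\<^sub>x(x) < f\<^sub>y(x)\<close> whenever \<open>x\<close>
  precedes \<open>y\<close>.  The order is complete, hence its topology is compact, and \<open>x \<mapsto> f\<^sub>x\<close> embeds it
  into the space of functions of \<open>s\<close> with pointwise convergence (\<open>embedding_map_point\<close>).

  It remains to find countably many continuous functions of \<open>s\<close> whose closure contains all \<open>f\<^sub>x\<close>
  and consists of functions of the first Baire class.  At stage \<open>n\<close>, one keeps finitely many
  coordinates, lets the parameter \<open>y\<close> run through a finite grid, and replaces the conditions
  \<open>s\<^sub>\<eta> = y\<^sub>\<eta>\<close> and \<open>s\<^sub>\<eta> < y\<^sub>\<eta>\<close> in the definition of \<open>f\<^sub>y\<close> by piecewise linear functions with a
  transition zone of width about \<open>1 / n\<close>.  Choosing grid points close to \<open>x\<close> yields a sequence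
  that converges to \<open>f\<^sub>x\<close> (\<open>point_in_closure\<close>).

  Conversely, let \<open>g\<close> be in the closure without being one of these functions.  Each stage
  is finite, so \<open>g\<close> is approached along \<open>n\<close> tending to infinity, with parameters \<open>y\<close> that
  accumulate at some \<open>x\<close> (\<open>cluster_parameter\<close>).  Consider two points \<open>s\<close> that first differ from \<open>x\<close>
  at the same coordinate \<open>\<delta>\<close> and on the same side.  For \<open>n\<close> large and \<open>y\<close> near \<open>x\<close> the
  approximating functions agree exactly at these points: they do not see coordinates beyond \<open>\<delta>\<close>,
  and the two points coincide before it (\<open>approx_cylinder_pos_eq\<close>).
  Hence \<open>g\<close> is constant on the set of all \<open>s\<close> with given \<open>\<delta>\<close> and side.  There are countably many such sets, each a countable union of
  closed sets, and a function that is constant on each of countably many closed sets covering a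
  normal space is a pointwise limit of continuous functions by Tietze's theorem
  (\<open>baire_one_if_constant_on_closed_pieces\<close>).

  Both classes of compacta are defined with spaces that live on sets of reals, so a copy of the
  cube is moved there along an injection.  As compact metrizable spaces are Polish, the compactum
  of class \<open>RK\<^sub>0\<close> and the embedded cube are both Rosenthal compacta.
\<close>

section \<open>General topology\<close>

text \<open>
  A complete order is compact in its order topology.  By Alexander's theorem only covers by
  rays matter.  If \<open>z\<close> is the infimum of the end points \<open>b\<close> of the covering rays above \<open>b\<close>,
  then none of these contains \<open>z\<close>, so some covering ray below \<open>a\<close> does; as \<open>a\<close> exceeds the
  infimum, it exceeds some such \<open>b\<close>, and the two rays together cover everything.
\<close>

lemma compact_space_order_topology_of:
  assumes cotrans: "\<And>x y z. \<lbrakk>x \<in> A; y \<in> A; z \<in> A; lt x z\<rbrakk> \<Longrightarrow> lt x y \<or> lt y z"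
    and glb: "\<And>Q. Q \<subseteq> A \<Longrightarrow>
      \<exists>z\<in>A. (\<forall>b\<in>Q. \<not> lt b z) \<and> (\<forall>y\<in>A. lt z y \<longrightarrow> (\<exists>b\<in>Q. lt b y))"
  shows "compact_space (order_topology_of A lt)"
proof -
  define S where "S = insert A ((\<lambda>a. {x \<in> A. lt x a}) ` A \<union> (\<lambda>a. {x \<in> A. lt a x}) ` A)"
  have US: "\<Union>S = A"
    by (auto simp: S_def)
  have top: "order_topology_of A lt = topology_generated_by S"
    by (simp add: order_topology_of_def S_def)
  have openS: "openin (order_topology_of A lt) U" if "U \<in> S" for U
    using that by (simp add: top topology_generated_by_Basis)
  have "topology (arbitrary union_of (finite intersection_of (\<lambda>x. x \<in> S) relative_to A))
      = order_topology_of A lt" (is "?T = _")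
  proof (rule topology_base_unique)
    fix U
    assume "(finite intersection_of (\<lambda>x. x \<in> S) relative_to A) U"
    then obtain F where F: "finite F" "F \<subseteq> S" "U = A \<inter> \<Inter>F"
      unfolding relative_to_def intersection_of_def by blast
    have "openin (order_topology_of A lt) (\<Inter>(insert A F))"
      using F openS by (intro openin_Inter) (auto simp: S_def)
    with F show "openin (order_topology_of A lt) U"
      by simp
  next
    fix U x
    assume "openin (order_topology_of A lt) U" "x \<in> U"
    then have "(arbitrary union_of finite' intersection_of (\<lambda>x. x \<in> S)) U"
      by (metis top generate_topology_on_eq openin_topology_generated_by_iff)
    then obtain \<V> where \<V>: "\<V> \<subseteq> Collect (finite' intersection_of (\<lambda>x. x \<in> S))" "\<Union>\<V> = U"
      unfolding union_of_def by blast
    with \<open>x \<in> U\<close> obtain V where V: "x \<in> V" "V \<subseteq> U" "(finite' intersection_of (\<lambda>x. x \<in> S)) V"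
      by blast
    then obtain F where F: "finite F" "F \<noteq> {}" "F \<subseteq> S" "x \<in> \<Inter>F" "\<Inter>F \<subseteq> U"
      unfolding intersection_of_def by blast
    then have "\<Inter>F \<subseteq> A"
      using US by blast
    have "(finite intersection_of (\<lambda>x. x \<in> S) relative_to A) (A \<inter> \<Inter>F)"
      using F(1,3) unfolding relative_to_def intersection_of_def by blast
    moreover have "A \<inter> \<Inter>F = \<Inter>F"
      using \<open>\<Inter>F \<subseteq> A\<close> by blast
    ultimately show "\<exists>B. (finite intersection_of (\<lambda>x. x \<in> S) relative_to A) B \<and> x \<in> B \<and> B \<subseteq> U"
      using F(4,5) by auto
  qed
  then show ?thesis
  proof (rule Alexander_subbase_alt[rotated 2])
    show "A \<subseteq> \<Union>S"
      using US by simp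
  next
    fix C
    assume "C \<subseteq> S" and cover: "A \<subseteq> \<Union>C"
    define Q where "Q = {b \<in> A. {x \<in> A. lt b x} \<in> C}"
    obtain z where z: "z \<in> A" "\<And>b. b \<in> Q \<Longrightarrow> \<not> lt b z"
      "\<And>y. y \<in> A \<Longrightarrow> lt z y \<Longrightarrow> \<exists>b\<in>Q. lt b y"
      using glb[of Q] unfolding Q_def by blast
    obtain U where U: "U \<in> C" "z \<in> U"
      using cover z(1) by blast
    \<comment> \<open>The carrier itself belongs to the subbase.\<close>
    with \<open>C \<subseteq> S\<close> consider "U = A" | a where "a \<in> A" "U = {x \<in> A. lt x a}"
      | b where "b \<in> A" "U = {x \<in> A. lt b x}"
      unfolding S_def by blast
    then show "\<exists>C'. finite C' \<and> C' \<subseteq> C \<and> A \<subseteq> \<Union>C'"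
    proof cases
      case 1
      with U show ?thesis by (intro exI[of _ "{U}"]) auto
    next
      case (2 a)
      with z(3) U obtain b where b: "b \<in> Q" "lt b a"
        by blast
      then have "A \<subseteq> \<Union>{U, {x \<in> A. lt b x}}"
        using 2 cotrans[of b _ a] unfolding Q_def by blast
      with b U show ?thesis
        unfolding Q_def by (intro exI[of _ "{U, {x \<in> A. lt b x}}"]) auto
    next
      case (3 b)
      with U z(2)[of b] show ?thesis
        unfolding Q_def by blast
    qed
  qed
qed

text \<open>
  On the union of the first \<open>n\<close> pieces the function is continuous, because finitely many closed
  pieces can be pasted.  Tietze's theorem extends it from there to the whole space, and the
  extensions converge because at each point they are eventually equal to the function.
\<close>

lemma baire_one_if_constant_on_closed_pieces:
  assumes X: "normal_space X" and ext: "f \<in> extensional (topspace X)"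
    and cnt: "countable \<C>" and closed: "\<And>C. C \<in> \<C> \<Longrightarrow> closedin X C"
    and cover: "topspace X \<subseteq> \<Union>\<C>"
    and const: "\<And>C p q. \<lbrakk>C \<in> \<C>; p \<in> C; q \<in> C\<rbrakk> \<Longrightarrow> f p = f q"
  shows "f \<in> baire_one X"
proof (cases "\<C> = {}")
  case True
  then show ?thesis
    using cover ext unfolding baire_one_def
    by (auto intro!: exI[of _ "\<lambda>_ _. 0"])
next
  case False
  define A where "A = from_nat_into \<C>"
  have A: "A m \<in> \<C>" for m
    using False by (simp add: A_def from_nat_into)
  have ran: "range A = \<C>"
    using False cnt by (simp add: A_def)
  have "\<exists>g. continuous_map X euclideanreal g \<and> (\<forall>p\<in>\<Union>(A ` {..<n}). g p = f p)" for n
  proof -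
    let ?S = "\<Union>(A ` {..<n})"
    have "closedin X ?S"
      using A closed by (intro closedin_Union) auto
    moreover have "continuous_map (subtopology X ?S) euclideanreal f"
    proof (rule pasting_lemma_closed[where I = "{..<n}" and T = "\<lambda>m. A m" and f = "\<lambda>_. f"])
      fix m assume "m \<in> {..<n}"
      then have "A m \<subseteq> ?S" by blast
      then show "closedin (subtopology X ?S) (A m)"
        using A closed closedin_subset_topspace by blast
      have "continuous_map (subtopology (subtopology X ?S) (A m)) euclideanreal (\<lambda>_. f (SOME p. p \<in> A m))"
        by simp
      then show "continuous_map (subtopology (subtopology X ?S) (A m)) euclideanreal f"
      proof (rule continuous_map_eq)
        fix q assume "q \<in> topspace (subtopology (subtopology X ?S) (A m))"
        then have "q \<in> A m" by auto
        then show "f (SOME p. p \<in> A m) = f q"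
          using const[OF A] by (metis someI)
      qed
    qed auto
    ultimately obtain g where "continuous_map X euclideanreal g" "\<And>p. p \<in> ?S \<Longrightarrow> g p = f p"
      using X by (rule_tac Tietze_extension_realinterval[of X ?S UNIV f]) auto
    then show ?thesis by blast
  qed
  then obtain g where g: "\<And>n. continuous_map X euclideanreal (g n)"
    "\<And>n p. p \<in> \<Union>(A ` {..<n}) \<Longrightarrow> g n p = f p"
    by metis
  have "(\<lambda>n. g n p) \<longlonglongrightarrow> f p" if p: "p \<in> topspace X" for p
  proof -
    obtain m where m: "p \<in> A m"
      using cover p ran by blast
    have "\<forall>\<^sub>F n in sequentially. g n p = f p"
      using eventually_gt_at_top[of m]
      by eventually_elim (use m in \<open>auto intro!: g(2)\<close>)
    then show ?thesis
      by (rule tendsto_eventually)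
  qed
  with g(1) ext show ?thesis
    unfolding baire_one_def by auto
qed

text \<open>
  The points of a union of finite families \<open>d n ` P n\<close> can accumulate at a new point \<open>g\<close> only
  along \<open>n\<close> tending to infinity, and when the parameters lie in a compact space, they then
  accumulate at some \<open>x\<close> simultaneously.  If no \<open>x\<close> worked, finitely many of the
  neighbourhoods that witness this would cover the parameters, and \<open>g\<close> would lie in the closure
  of finitely many of the finite families.
\<close>

lemma cluster_parameter:
  fixes P :: "nat \<Rightarrow> 'b set"
  assumes Q: "compact_space Q" and Y: "t1_space Y"
    and fin: "\<And>n. finite (P n)" and PQ: "\<And>n. P n \<subseteq> topspace Q"
    and dY: "\<And>n y. y \<in> P n \<Longrightarrow> d n y \<in> topspace Y"
    and g: "g \<in> Y closure_of (\<Union>n. d n ` P n)" and gD: "g \<notin> (\<Union>n. d n ` P n)"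
  shows "\<exists>x\<in>topspace Q. \<forall>U W N. openin Q U \<and> x \<in> U \<and> openin Y W \<and> g \<in> W \<longrightarrow>
    (\<exists>n\<ge>N. \<exists>y\<in>P n \<inter> U. d n y \<in> W)"
proof (rule ccontr)
  assume "\<not> ?thesis"
  then have "\<forall>x\<in>topspace Q. \<exists>U W N. openin Q U \<and> x \<in> U \<and> openin Y W \<and> g \<in> W \<and>
      (\<forall>n\<ge>N. \<forall>y\<in>P n \<inter> U. d n y \<notin> W)"
    by simp
  then obtain U W N where UWN: "\<And>x. x \<in> topspace Q \<Longrightarrow> openin Q (U x) \<and> x \<in> U x \<and> openin Y (W x) \<and>
      g \<in> W x \<and> (\<forall>n\<ge>N x. \<forall>y\<in>P n \<inter> U x. d n y \<notin> W x)"
    by metis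
  obtain F where F: "finite F" "F \<subseteq> topspace Q" "topspace Q \<subseteq> \<Union>(U ` F)"
  proof -
    have "\<exists>\<F>. finite \<F> \<and> \<F> \<subseteq> U ` topspace Q \<and> topspace Q \<subseteq> \<Union>\<F>"
    proof (rule compactinD)
      show "compactin Q (topspace Q)"
        using Q by (simp add: compact_space_def)
      show "topspace Q \<subseteq> \<Union>(U ` topspace Q)"
        using UWN by blast
    qed (use UWN in blast)
    then show ?thesis
      using that by (metis finite_subset_image)
  qed
  have gY: "g \<in> topspace Y"
    using g by (simp add: in_closure_of)
  define M where "M = Max (insert 0 (N ` F))"
  have M: "N x \<le> M" if "x \<in> F" for x
    using that F(1) by (simp add: M_def)
  define D0 where "D0 = (\<Union>n<M. d n ` P n)"
  define V where "V = (topspace Y - D0) \<inter> (topspace Y \<inter> \<Inter>(W ` F))"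
  have "finite D0" "D0 \<subseteq> topspace Y"
    using fin dY by (auto simp: D0_def)
  then have "closedin Y D0"
    using Y by (simp add: t1_space_closedin_finite)
  moreover have "openin Y (topspace Y \<inter> \<Inter>(W ` F))"
  proof (cases "F = {}")
    case False
    then show ?thesis
      using F UWN by (intro openin_Int openin_topspace openin_Inter) auto
  qed simp
  ultimately have "openin Y V"
    unfolding V_def by blast
  moreover have "g \<in> V"
    using gY gD UWN F(2) by (auto simp: V_def D0_def)
  ultimately obtain n y where ny: "y \<in> P n" "d n y \<in> V"
    using g unfolding in_closure_of by blast
  then have "n \<ge> M"
    unfolding V_def D0_def by (meson DiffD2 IntD1 UN_I image_eqI lessThan_iff not_le)
  moreover obtain x where "x \<in> F" "y \<in> U x"
    using ny PQ F(3) by blast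
  ultimately show False
    using UWN[of x] F(2) M[of x] ny unfolding V_def by fastforce
qed

text \<open>
  Completeness comes from local compactness; the centres of finite covers by balls of
  radius \<open>1 / (n + 1)\<close> form a countable dense set.
\<close>

lemma compact_metrizable_imp_polish:
  assumes "compact_space X" "metrizable_space X"
  shows "polish X"
proof -
  have "completely_metrizable_space X"
    using assms by (simp add: compact_imp_locally_compact_space locally_compact_imp_completely_metrizable_space)
  moreover have "separable_space X"
  proof -
    obtain M d where "Metric_space M d" and X: "X = Metric_space.mtopology M d"
      using assms(2) unfolding metrizable_space_def by blast
    then interpret Metric_space M d by simp
    have "mtotally_bounded M"
      using assms(1) by (simp add: X compact_space_def compactin_imp_mtotally_bounded)
    then have "\<exists>K. finite K \<and> K \<subseteq> M \<and> M \<subseteq> (\<Union>x\<in>K. mball x (1 / Suc n))" for n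
      unfolding mtotally_bounded_def by (meson zero_less_divide_1_iff of_nat_0_less_iff zero_less_Suc)
    then obtain K where K: "\<And>n. finite (K n)" "\<And>n. K n \<subseteq> M"
        "\<And>n. M \<subseteq> (\<Union>x\<in>K n. mball x (1 / Suc n))"
      by metis
    have "x \<in> X closure_of (\<Union>n. K n)" if "x \<in> M" for x
    proof -
      have "\<exists>y\<in>\<Union>(range K). y \<in> mball x e" if "e > 0" for e
    proof -
      from that obtain n where n: "1 / Suc n < e"
        using nat_approx_posE by blast
      obtain y where "y \<in> K n" "x \<in> mball y (1 / Suc n)"
        using K(3) \<open>x \<in> M\<close> by blast
      then show ?thesis
        using n by (auto simp: commute intro!: bexI[of _ y])
    qed
    then show ?thesis
      using \<open>x \<in> M\<close> by (auto simp: X metric_closure_of)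
    qed
    then have "X closure_of (\<Union>n. K n) = topspace X"
      by (intro subset_antisym closure_of_subset_topspace) (auto simp: X)
    moreover have "(\<Union>n. K n) \<subseteq> topspace X"
      using K(2) by (simp add: X UN_least)
    moreover have "countable (\<Union>n. K n)"
      using K(1) by (simp add: countable_finite)
    ultimately show ?thesis
      unfolding separable_space_def by blast
  qed
  ultimately show ?thesis
    by (simp add: polish_def)
qed

section \<open>The lexicographic order on the cube\<close>

locale countable_ordinal =
  fixes r :: "'a rel"
  assumes wo: "Well_order r" and countable_Field: "countable (Field r)"
begin

lemma underS_trans: "\<delta> \<in> underS r \<gamma> \<Longrightarrow> \<gamma> \<in> underS r \<eta> \<Longrightarrow> \<delta> \<in> underS r \<eta>"
  using wo_rel.TRANS[of r] wo_rel.ANTISYM[of r] wo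
  unfolding wo_rel_def underS_def by (auto dest: transD antisymD)

lemma underS_irrefl: "\<gamma> \<notin> underS r \<gamma>"
  by (simp add: underS_def)

lemma underS_Field: "\<delta> \<in> underS r \<gamma> \<Longrightarrow> \<delta> \<in> Field r"
  by (auto simp: underS_def Field_def)

lemma underS_linear:
  assumes "\<delta> \<in> Field r" "\<gamma> \<in> Field r"
  shows "\<delta> \<in> underS r \<gamma> \<or> \<delta> = \<gamma> \<or> \<gamma> \<in> underS r \<delta>"
  using wo_rel.TOTALS[of r] wo assms
  unfolding wo_rel_def underS_def by auto

text \<open>
  The well-order makes a first coordinate of disagreement available whenever there is some
  coordinate of disagreement, and any statement about the lexicographic order is a statement
  about this coordinate.
\<close>

definition first_diff :: "('a \<Rightarrow> real) \<Rightarrow> ('a \<Rightarrow> real) \<Rightarrow> 'a \<Rightarrow> bool" where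
  "first_diff s x \<delta> \<longleftrightarrow> \<delta> \<in> Field r \<and> (\<forall>\<eta>\<in>underS r \<delta>. s \<eta> = x \<eta>) \<and> s \<delta> \<noteq> x \<delta>"

lemma first_diff_exists:
  assumes "\<gamma> \<in> Field r" "s \<gamma> \<noteq> x \<gamma>"
  obtains \<delta> where "first_diff s x \<delta>" "\<delta> \<in> underS r \<gamma> \<or> \<delta> = \<gamma>"
proof -
  have "wf (r - Id)"
    using wo wo_rel.WF wo_rel_def by blast
  then obtain \<delta> where \<delta>: "\<delta> \<in> {\<delta> \<in> Field r. s \<delta> \<noteq> x \<delta>}"
      "\<And>\<eta>. (\<eta>, \<delta>) \<in> r - Id \<Longrightarrow> \<eta> \<notin> {\<delta> \<in> Field r. s \<delta> \<noteq> x \<delta>}"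
    using assms wfE_min[of "r - Id" \<gamma> "{\<delta> \<in> Field r. s \<delta> \<noteq> x \<delta>}"] by blast
  then have "first_diff s x \<delta>"
    unfolding first_diff_def by (auto simp: underS_def Field_def)
  moreover have "\<gamma> \<notin> underS r \<delta>"
    using \<delta>(2)[of \<gamma>] assms by (auto simp: underS_def)
  ultimately show thesis
    using that underS_linear[of \<delta> \<gamma>] assms(1) \<delta>(1) by blast
qed

lemma first_diff_unique: "first_diff s x \<gamma> \<Longrightarrow> first_diff s x \<delta> \<Longrightarrow> \<gamma> = \<delta>"
  using underS_linear unfolding first_diff_def by metis

lemma lex_less_iff_first_diff: "lex_less r x y \<longleftrightarrow> (\<exists>\<gamma>. first_diff x y \<gamma> \<and> x \<gamma> < y \<gamma>)"
  unfolding lex_less_def first_diff_def by force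

lemma lex_cubeD: "x \<in> lex_cube r \<Longrightarrow> \<gamma> \<in> Field r \<Longrightarrow> 0 \<le> x \<gamma> \<and> x \<gamma> \<le> 1"
  by (force simp: lex_cube_def)

text \<open>
  Co-transitivity stands in for totality and transitivity of the order: it is exactly what
  makes the ray above \<open>x\<close> and the ray below \<open>z\<close> cover everything.
\<close>

lemma lex_less_cotrans:
  assumes "lex_less r x z"
  shows "lex_less r x y \<or> lex_less r y z"
proof -
  obtain \<gamma> where \<gamma>: "\<gamma> \<in> Field r" "\<forall>\<eta>\<in>underS r \<gamma>. x \<eta> = z \<eta>" "x \<gamma> < z \<gamma>"
    using assms unfolding lex_less_def by blast
  show ?thesis
  proof (cases "\<forall>\<eta>\<in>underS r \<gamma>. x \<eta> = y \<eta>")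
    case True
    then show ?thesis
      using \<gamma> unfolding lex_less_def by (cases "x \<gamma> < y \<gamma>") force+
  next
    case False
    then obtain \<eta> where "\<eta> \<in> underS r \<gamma>" "x \<eta> \<noteq> y \<eta>"
      by blast
    then obtain \<delta> where "first_diff x y \<delta>" "\<delta> \<in> underS r \<gamma>"
      using first_diff_exists underS_Field underS_trans by metis
    then show ?thesis
      using \<gamma>(2) underS_trans[of _ \<delta> \<gamma>] unfolding lex_less_def first_diff_def
      by (cases "x \<delta> < y \<delta>") force+
  qed
qed

lemma well_order_recursion:
  assumes "\<And>f g \<gamma>. (\<And>\<delta>. \<delta> \<in> underS r \<gamma> \<Longrightarrow> f \<delta> = g \<delta>) \<Longrightarrow> H f \<gamma> = H g \<gamma>"
  obtains f where "f = H f"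
proof -
  have "wo_rel.adm_wo r H"
    using assms wo unfolding wo_rel_def wo_rel.adm_wo_def[OF wo[folded wo_rel_def]] by blast
  then show thesis
    using that wo_rel.worec_fixpoint wo unfolding wo_rel_def by blast
qed

text \<open>
  The coordinates of the infimum are found by transfinite recursion: once those below \<open>\<gamma>\<close> are
  known, only the members of \<open>Q\<close> that agree with them still compete, and the infimum of their
  values is taken at \<open>\<gamma>\<close>.  When no member is left, the default must be \<open>1\<close>, the largest value,
  for the result to be the greatest lower bound.
\<close>

lemma lex_cube_glb:
  assumes "Q \<subseteq> lex_cube r"
  shows "\<exists>z\<in>lex_cube r. (\<forall>b\<in>Q. \<not> lex_less r b z) \<and>
    (\<forall>y\<in>lex_cube r. lex_less r z y \<longrightarrow> (\<exists>b\<in>Q. lex_less r b y))"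
proof -
  define above where "above f \<gamma> = {b \<gamma> |b. b \<in> Q \<and> (\<forall>\<delta>\<in>underS r \<gamma>. b \<delta> = f \<delta>)}" for f \<gamma>
  define H where "H f \<gamma> = (if above f \<gamma> = {} then 1 else Inf (above f \<gamma>))" for f \<gamma>
  have above_cong: "above f \<gamma> = above g \<gamma>" if "\<And>\<delta>. \<delta> \<in> underS r \<gamma> \<Longrightarrow> f \<delta> = g \<delta>" for f g \<gamma>
    unfolding above_def using that by force
  obtain f where fix_point: "f = H f"
  proof (rule well_order_recursion)
    show "H f \<gamma> = H g \<gamma>" if "\<And>\<delta>. \<delta> \<in> underS r \<gamma> \<Longrightarrow> f \<delta> = g \<delta>" for f g \<gamma>
      using above_cong[OF that] by (simp add: H_def)
  qed
  define z where "z = restrict f (Field r)"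
  have z: "z \<gamma> = H z \<gamma>" if "\<gamma> \<in> Field r" for \<gamma>
  proof -
    have "above z \<gamma> = above f \<gamma>"
      by (rule above_cong) (simp add: z_def underS_Field)
    then have "H z \<gamma> = H f \<gamma>"
      by (simp add: H_def)
    then show ?thesis
      using that fun_cong[OF fix_point, of \<gamma>] by (simp add: z_def)
  qed
  have above01: "above f \<gamma> \<subseteq> {0..1}" if "\<gamma> \<in> Field r" for f \<gamma>
    using assms that lex_cubeD unfolding above_def by fastforce
  then have bdd: "bdd_below (above f \<gamma>)" if "\<gamma> \<in> Field r" for f \<gamma>
    using that by (meson bdd_below_Icc bdd_below_mono)
  have "0 \<le> z \<gamma> \<and> z \<gamma> \<le> 1" if \<gamma>: "\<gamma> \<in> Field r" for \<gamma>
  proof (cases "above z \<gamma> = {}")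
    case False
    then obtain a where a: "a \<in> above z \<gamma>" by blast
    have "Inf (above z \<gamma>) \<le> a"
      using a bdd[OF \<gamma>] by (rule cInf_lower)
    moreover have "0 \<le> Inf (above z \<gamma>)"
      using False subsetD[OF above01[OF \<gamma>]] by (intro cInf_greatest) (blast, metis atLeastAtMost_iff)
    ultimately show ?thesis
      using False z[OF \<gamma>] subsetD[OF above01[OF \<gamma>] a] by (simp add: H_def)
  qed (use z[OF \<gamma>] in \<open>simp add: H_def\<close>)
  then have "z \<in> lex_cube r"
    by (auto simp: lex_cube_def z_def)
  moreover have "\<not> lex_less r b z" if "b \<in> Q" for b
  proof
    assume "lex_less r b z"
    then obtain \<gamma> where \<gamma>: "\<gamma> \<in> Field r" "\<forall>\<delta>\<in>underS r \<gamma>. b \<delta> = z \<delta>" "b \<gamma> < z \<gamma>"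
      unfolding lex_less_def by blast
    then have b: "b \<gamma> \<in> above z \<gamma>"
      unfolding above_def using that by blast
    then have "Inf (above z \<gamma>) \<le> b \<gamma>"
      using bdd[OF \<gamma>(1)] by (rule cInf_lower)
    then show False
      using b \<gamma>(3) z[OF \<gamma>(1)] by (auto simp: H_def split: if_splits)
  qed
  moreover have "\<exists>b\<in>Q. lex_less r b y" if "y \<in> lex_cube r" "lex_less r z y" for y
  proof -
    obtain \<gamma> where \<gamma>: "\<gamma> \<in> Field r" "\<forall>\<delta>\<in>underS r \<gamma>. z \<delta> = y \<delta>" "z \<gamma> < y \<gamma>"
      using \<open>lex_less r z y\<close> unfolding lex_less_def by blast
    have "y \<gamma> \<le> 1"
      using lex_cubeD that(1) \<gamma>(1) by blast
    then have "above z \<gamma> \<noteq> {}" "Inf (above z \<gamma>) < y \<gamma>"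
      using z[OF \<gamma>(1)] \<gamma>(3) by (auto simp: H_def split: if_splits)
    then obtain a where "a \<in> above z \<gamma>" "a < y \<gamma>"
      by (meson cInf_lessD)
    then obtain b where "b \<in> Q" "\<forall>\<delta>\<in>underS r \<gamma>. b \<delta> = z \<delta>" "b \<gamma> < y \<gamma>"
      unfolding above_def by blast
    with \<gamma> show ?thesis
      unfolding lex_less_def by (metis (no_types, lifting))
  qed
  ultimately show ?thesis
    by blast
qed

lemma compact_space_lex_cube: "compact_space (lex_cube_topology r)"
  unfolding lex_cube_topology_def
  by (rule compact_space_order_topology_of) (use lex_less_cotrans lex_cube_glb in blast)+

section \<open>Continuous functions for the lexicographic order\<close>

text \<open>
  The points that agree with \<open>s\<close> below \<open>\<gamma>\<close> form an interval of the lexicographic order.  The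
  function \<open>cylinder_pos \<gamma> s\<close> is the coordinate at \<open>\<gamma>\<close> on this interval and is continued
  by \<open>0\<close> to the left and by \<open>1\<close> to the right of it.
\<close>

definition cylinder_pos :: "'a \<Rightarrow> ('a \<Rightarrow> real) \<Rightarrow> ('a \<Rightarrow> real) \<Rightarrow> real" where
  "cylinder_pos \<gamma> s x = (if \<forall>\<eta>\<in>underS r \<gamma>. s \<eta> = x \<eta> then x \<gamma>
     else if \<exists>\<delta>\<in>underS r \<gamma>. first_diff s x \<delta> \<and> s \<delta> < x \<delta> then 1 else 0)"

lemma cylinder_pos_agree: "\<forall>\<eta>\<in>underS r \<gamma>. s \<eta> = x \<eta> \<Longrightarrow> cylinder_pos \<gamma> s x = x \<gamma>"
  by (simp add: cylinder_pos_def)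

lemma cylinder_pos_first_diff:
  assumes "first_diff s x \<delta>" "\<delta> \<in> underS r \<gamma>"
  shows "cylinder_pos \<gamma> s x = (if s \<delta> < x \<delta> then 1 else 0)"
proof -
  have "\<not> (\<forall>\<eta>\<in>underS r \<gamma>. s \<eta> = x \<eta>)"
    using assms by (auto simp: first_diff_def)
  moreover have "(\<exists>\<delta>\<in>underS r \<gamma>. first_diff s x \<delta> \<and> s \<delta> < x \<delta>) \<longleftrightarrow> s \<delta> < x \<delta>"
    using assms first_diff_unique by blast
  ultimately show ?thesis
    by (simp only: cylinder_pos_def if_False)
qed

lemma cylinder_pos_cases:
  obtains (agree) "\<forall>\<eta>\<in>underS r \<gamma>. s \<eta> = x \<eta>" "cylinder_pos \<gamma> s x = x \<gamma>"
  | (above) \<delta> where "\<delta> \<in> underS r \<gamma>" "first_diff s x \<delta>" "s \<delta> < x \<delta>" "cylinder_pos \<gamma> s x = 1"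
  | (below) \<delta> where "\<delta> \<in> underS r \<gamma>" "first_diff s x \<delta>" "x \<delta> < s \<delta>" "cylinder_pos \<gamma> s x = 0"
proof (cases "\<forall>\<eta>\<in>underS r \<gamma>. s \<eta> = x \<eta>")
  case True
  then show thesis
    using agree cylinder_pos_agree by blast
next
  case False
  then obtain \<eta> where "\<eta> \<in> underS r \<gamma>" "s \<eta> \<noteq> x \<eta>"
    by blast
  then obtain \<delta> where \<delta>: "first_diff s x \<delta>" "\<delta> \<in> underS r \<gamma>"
    using first_diff_exists underS_Field underS_trans by metis
  then show thesis
    using above[of \<delta>] below[of \<delta>] cylinder_pos_first_diff[OF \<delta>]
    by (metis first_diff_def linorder_neqE_linordered_idom)
qed

lemma cylinder_pos_range: "x \<in> lex_cube r \<Longrightarrow> \<gamma> \<in> Field r \<Longrightarrow> 0 \<le> cylinder_pos \<gamma> s x \<and> cylinder_pos \<gamma> s x \<le> 1"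
  using lex_cubeD by (cases rule: cylinder_pos_cases[of \<gamma> s x]) auto

text \<open>
  Except for trivial levels, the sets where the function exceeds, or stays below, a level \<open>t\<close>
  are open rays: their end point follows \<open>s\<close> below \<open>\<gamma>\<close>, takes the value \<open>t\<close> at \<open>\<gamma>\<close>, and continues with the
  extreme value \<open>1\<close>, respectively \<open>0\<close>.
\<close>

lemma continuous_map_cylinder_pos:
  assumes s: "s \<in> lex_cube r" and \<gamma>: "\<gamma> \<in> Field r"
  shows "continuous_map (lex_cube_topology r) euclideanreal (cylinder_pos \<gamma> s)"
proof -
  let ?T = "lex_cube_topology r"
  have top: "topspace ?T = lex_cube r"
    by (simp add: lex_cube_topology_def)
  \<comment> \<open>The end point of a ray: \<open>s\<close> below \<open>\<gamma>\<close>, then \<open>t\<close>, then constantly \<open>e\<close>.\<close>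
  define pt where "pt t e = (\<lambda>\<eta>\<in>Field r. if \<eta> \<in> underS r \<gamma> then s \<eta> else if \<eta> = \<gamma> then t else e)"
    for t e :: real
  have pt_under: "pt t e \<eta> = s \<eta>" if "\<eta> \<in> underS r \<gamma>" for t e \<eta>
    using that underS_Field by (simp add: pt_def)
  have pt_at: "pt t e \<gamma> = t" for t e
    using \<gamma> by (simp add: pt_def underS_irrefl)
  have pt_cube: "pt t e \<in> lex_cube r" if "t \<in> {0..1}" "e \<in> {0..1}" for t e
    using that lex_cubeD[OF s] by (auto simp: lex_cube_def pt_def)
  have open_below: "openin ?T {x \<in> lex_cube r. lex_less r x a}" 
   and open_above: "openin ?T {x \<in> lex_cube r. lex_less r a x}" if "a \<in> lex_cube r" for a
    using that unfolding lex_cube_topology_def order_topology_of_def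
    by (auto intro!: topology_generated_by_Basis)
  have above: "t < cylinder_pos \<gamma> s x \<longleftrightarrow> lex_less r (pt t 1) x"
    if t: "0 \<le> t" "t < 1" and x: "x \<in> lex_cube r" for t x
  proof
    assume lt: "t < cylinder_pos \<gamma> s x"
    show "lex_less r (pt t 1) x"
    proof (cases rule: cylinder_pos_cases[of \<gamma> s x])
      case agree
      then show ?thesis
        using lt \<gamma> pt_under pt_at unfolding lex_less_def by (intro bexI[of _ \<gamma>]) auto
    next
      case (above \<delta>)
      then show ?thesis
        using pt_under underS_trans underS_Field unfolding lex_less_def first_diff_def
        by (intro bexI[of _ \<delta>]) auto
    qed (use lt t in auto)
  next
    assume "lex_less r (pt t 1) x"
    then obtain \<delta> where \<delta>: "\<delta> \<in> Field r" "\<forall>\<eta>\<in>underS r \<delta>. pt t 1 \<eta> = x \<eta>" "pt t 1 \<delta> < x \<delta>"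
      unfolding lex_less_def by blast
    then consider "\<delta> \<in> underS r \<gamma>" | "\<delta> = \<gamma>"
      using lex_cubeD[OF x \<delta>(1)] by (force simp: pt_def split: if_splits)
    then show "t < cylinder_pos \<gamma> s x"
    proof cases
      case 1
      then have "first_diff s x \<delta>" "s \<delta> < x \<delta>"
        using \<delta> pt_under underS_trans unfolding first_diff_def by (metis order_less_irrefl)+
      then show ?thesis
        using 1 t cylinder_pos_first_diff by simp
    next
      case 2
      then show ?thesis
        using \<delta> pt_under pt_at cylinder_pos_agree by metis
    qed
  qed
  have below: "cylinder_pos \<gamma> s x < t \<longleftrightarrow> lex_less r x (pt t 0)"
    if t: "0 < t" "t \<le> 1" and x: "x \<in> lex_cube r" for t x
  proof
    assume lt: "cylinder_pos \<gamma> s x < t"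
    show "lex_less r x (pt t 0)"
    proof (cases rule: cylinder_pos_cases[of \<gamma> s x])
      case agree
      then show ?thesis
        using lt \<gamma> pt_under pt_at unfolding lex_less_def by (intro bexI[of _ \<gamma>]) auto
    next
      case (below \<delta>)
      then show ?thesis
        using pt_under underS_trans underS_Field unfolding lex_less_def first_diff_def
        by (intro bexI[of _ \<delta>]) auto
    qed (use lt t in auto)
  next
    assume "lex_less r x (pt t 0)"
    then obtain \<delta> where \<delta>: "\<delta> \<in> Field r" "\<forall>\<eta>\<in>underS r \<delta>. x \<eta> = pt t 0 \<eta>" "x \<delta> < pt t 0 \<delta>"
      unfolding lex_less_def by blast
    then consider "\<delta> \<in> underS r \<gamma>" | "\<delta> = \<gamma>"
      using lex_cubeD[OF x \<delta>(1)] by (force simp: pt_def split: if_splits)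
    then show "cylinder_pos \<gamma> s x < t"
    proof cases
      case 1
      then have "first_diff s x \<delta>" "x \<delta> < s \<delta>"
        using \<delta> pt_under underS_trans unfolding first_diff_def by (metis order_less_irrefl)+
      then show ?thesis
        using 1 t cylinder_pos_first_diff by simp
    next
      case 2
      then show ?thesis
        using \<delta> pt_under pt_at cylinder_pos_agree by metis
    qed
  qed
  show ?thesis
    unfolding continuous_map_upper_lower_semicontinuous_lt top
  proof (intro conjI allI)
    fix t :: real
    consider "t < 0" | "0 \<le> t" "t < 1" | "t \<ge> 1" by linarith
    then show "openin ?T {x \<in> lex_cube r. t < cylinder_pos \<gamma> s x}"
    proof cases
      case 1
      then have "{x \<in> lex_cube r. t < cylinder_pos \<gamma> s x} = topspace ?T"
        using cylinder_pos_range[OF _ \<gamma>, of _ s] by (auto simp: top intro: less_le_trans)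
      then show ?thesis by (metis openin_topspace)
    next
      case 2
      then have "{x \<in> lex_cube r. t < cylinder_pos \<gamma> s x} = {x \<in> lex_cube r. lex_less r (pt t 1) x}"
        using above by blast
      then show ?thesis
        using open_above pt_cube 2 by simp
    next
      case 3
      then have "{x \<in> lex_cube r. t < cylinder_pos \<gamma> s x} = {}"
        using cylinder_pos_range[OF _ \<gamma>, of _ s] by (force simp: not_less)
      then show ?thesis by (metis openin_empty)
    qed
    consider "t \<le> 0" | "0 < t" "t \<le> 1" | "t > 1" by linarith
    then show "openin ?T {x \<in> lex_cube r. cylinder_pos \<gamma> s x < t}"
    proof cases
      case 1
      then have "{x \<in> lex_cube r. cylinder_pos \<gamma> s x < t} = {}"
        using cylinder_pos_range[OF _ \<gamma>, of _ s] by (force simp: not_less)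
      then show ?thesis by (metis openin_empty)
    next
      case 2
      then have "{x \<in> lex_cube r. cylinder_pos \<gamma> s x < t} = {x \<in> lex_cube r. lex_less r x (pt t 0)}"
        using below by blast
      then show ?thesis
        using open_below pt_cube 2 by simp
    next
      case 3
      then have "{x \<in> lex_cube r. cylinder_pos \<gamma> s x < t} = topspace ?T"
        using cylinder_pos_range[OF _ \<gamma>, of _ s] by (auto simp: top intro: le_less_trans)
      then show ?thesis by (metis openin_topspace)
    qed
  qed
qed

end

section \<open>Continuous approximations in the product topology\<close>

text \<open>
  Two piecewise linear functions of the signed distance \<open>t\<close> between coordinates.  They
  imitate the indicators of \<open>t = 0\<close> and of \<open>t < 0\<close>: for \<open>\<bar>t\<bar> \<ge> 1 / (n + 1)\<close> they have the same
  values as these, and for \<open>\<bar>t\<bar> \<le> 1 / (2 (n + 1))\<close> they keep the values \<open>1\<close> and \<open>0\<close> of \<open>t = 0\<close>.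
  The plateau around \<open>0\<close> lets a nearby grid point replace a given point without any error in
  these factors.
\<close>

definition plateau :: "nat \<Rightarrow> real \<Rightarrow> real" where
  "plateau n t = max 0 (min 1 (2 - 2 * real (Suc n) * \<bar>t\<bar>))"

definition ramp :: "nat \<Rightarrow> real \<Rightarrow> real" where
  "ramp n t = max 0 (min 1 (- 2 * real (Suc n) * t - 1))"

lemma plateau_nonneg: "0 \<le> plateau n t"
  by (simp add: plateau_def)

lemma ramp_nonneg: "0 \<le> ramp n t"
  by (simp add: ramp_def)

lemma
  assumes "\<bar>t\<bar> \<le> 1 / (2 * real (Suc n))"
  shows plateau_near: "plateau n t = 1" and ramp_near: "ramp n t = 0"
proof -
  have "2 * real (Suc n) * \<bar>t\<bar> \<le> 1"
    using assms by (simp add: field_simps)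
  moreover have "- 2 * real (Suc n) * t \<le> \<bar>2 * real (Suc n) * t\<bar>"
    by linarith
  moreover have "\<bar>2 * real (Suc n) * t\<bar> = 2 * real (Suc n) * \<bar>t\<bar>"
    by (simp add: abs_mult)
  ultimately show "plateau n t = 1" "ramp n t = 0"
    unfolding plateau_def ramp_def by linarith+
qed

lemma
  assumes "\<bar>t\<bar> \<ge> 1 / real (Suc n)"
  shows plateau_far: "plateau n t = 0" and ramp_far: "ramp n t = (if t < 0 then 1 else 0)"
proof -
  have ge: "real (Suc n) * \<bar>t\<bar> \<ge> 1"
    using assms by (simp add: field_simps)
  show "plateau n t = 0"
    using ge unfolding plateau_def by linarith
  show "ramp n t = (if t < 0 then 1 else 0)"
  proof (cases "t < 0")
    case True
    then have "real (Suc n) * \<bar>t\<bar> = - (real (Suc n) * t)"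
      by simp
    then have "ramp n t = 1"
      using ge unfolding ramp_def by linarith
    with True show ?thesis
      by simp
  next
    case False
    then have "0 \<le> real (Suc n) * t" by simp
    then have "ramp n t = 0"
      unfolding ramp_def by linarith
    with False show ?thesis
      by simp
  qed
qed

lemma continuous_map_plateau:
  "continuous_map X euclideanreal f \<Longrightarrow> continuous_map X euclideanreal (\<lambda>p. plateau n (f p))"
  unfolding plateau_def by (intro continuous_intros continuous_map_real_mult_left) auto

lemma continuous_map_ramp:
  "continuous_map X euclideanreal f \<Longrightarrow> continuous_map X euclideanreal (\<lambda>p. ramp n (f p))"
  unfolding ramp_def by (intro continuous_intros continuous_map_real_mult_left) auto

context countable_ordinal
begin

definition weight :: "'a set \<Rightarrow> nat \<Rightarrow> ('a \<Rightarrow> real) \<Rightarrow> ('a \<Rightarrow> real) \<Rightarrow> 'a \<Rightarrow> real" where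
  "weight E n s y \<gamma> = (\<Prod>\<eta>\<in>E \<inter> underS r \<gamma>. plateau n (s \<eta> - y \<eta>))"

text \<open>
  The position with respect to a cylinder unfolds as a sum over the place of the first
  disagreement.  The approximation keeps the places in a finite set \<open>E\<close> and replaces
  ``agreement below \<open>\<eta>\<close>'' by a product of plateaus and ``\<open>s \<eta> < y \<eta>\<close>'' by a ramp, which makes it
  continuous in \<open>s\<close> for the product topology.  The truncation makes the bound
  \<open>1\<close> immediate.
\<close>

definition approx_cylinder_pos :: "'a set \<Rightarrow> nat \<Rightarrow> 'a \<Rightarrow> ('a \<Rightarrow> real) \<Rightarrow> ('a \<Rightarrow> real) \<Rightarrow> real" where
  "approx_cylinder_pos E n \<gamma> s y = min 1
     ((\<Sum>\<eta>\<in>E \<inter> underS r \<gamma>. weight E n s y \<eta> * ramp n (s \<eta> - y \<eta>)) + weight E n s y \<gamma> * y \<gamma>)"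

lemma weight_cong:
  "(\<And>\<eta>. \<eta> \<in> underS r \<gamma> \<Longrightarrow> s \<eta> = s' \<eta>) \<Longrightarrow> weight E n s y \<gamma> = weight E n s' y \<gamma>"
  unfolding weight_def by (intro prod.cong) auto

lemma weight_zero:
  assumes "finite E" "\<delta> \<in> E" "\<delta> \<in> underS r \<gamma>" "1 / real (Suc n) \<le> \<bar>s \<delta> - y \<delta>\<bar>"
  shows "weight E n s y \<gamma> = 0"
  unfolding weight_def using assms plateau_far by (intro prod_zero) auto

lemma weight_one:
  assumes "\<And>\<eta>. \<eta> \<in> E \<inter> underS r \<gamma> \<Longrightarrow> \<bar>s \<eta> - y \<eta>\<bar> \<le> 1 / (2 * real (Suc n))"
  shows "weight E n s y \<gamma> = 1"
  unfolding weight_def using assms plateau_near by (intro prod.neutral) auto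

lemma weight_nonneg: "0 \<le> weight E n s y \<gamma>"
  unfolding weight_def by (intro prod_nonneg) (simp add: plateau_nonneg)

lemma approx_cylinder_pos_range:
  assumes "0 \<le> y \<gamma>"
  shows "0 \<le> approx_cylinder_pos E n \<gamma> s y \<and> approx_cylinder_pos E n \<gamma> s y \<le> 1"
  unfolding approx_cylinder_pos_def using assms weight_nonneg ramp_nonneg
  by (auto intro!: add_nonneg_nonneg sum_nonneg mult_nonneg_nonneg)

lemma continuous_map_approx_cylinder_pos:
  assumes "finite E" and "\<And>\<eta>. \<eta> \<in> E \<Longrightarrow> continuous_map X euclideanreal (\<lambda>p. h p \<eta>)"
  shows "continuous_map X euclideanreal (\<lambda>p. approx_cylinder_pos E n \<gamma> (h p) y)"
proof -
  have w: "continuous_map X euclideanreal (\<lambda>p. weight E n (h p) y \<eta>)" for \<eta>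
    unfolding weight_def using assms
    by (intro continuous_map_prod continuous_map_plateau continuous_map_diff) auto
  show ?thesis
    unfolding approx_cylinder_pos_def using assms w
    by (intro continuous_map_real_min continuous_map_add continuous_map_sum
        continuous_map_real_mult continuous_map_ramp continuous_map_diff) auto
qed

text \<open>
  This is the reason why limits of the approximations are tame.  If \<open>s\<close> and \<open>s'\<close> agree below \<open>\<delta>\<close>
  and lie at \<open>\<delta>\<close> on the same side of \<open>y\<close> with a clear margin, then the approximation cannot
  tell them apart: terms up to \<open>\<delta>\<close> coincide, and all later ones contain the factor
  at \<open>\<delta>\<close>, which vanishes.
\<close>

lemma approx_cylinder_pos_eq:
  assumes E: "finite E" "\<delta> \<in> E" and Field: "\<delta> \<in> Field r" "\<gamma> \<in> Field r" "E \<subseteq> Field r"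
    and agree: "\<And>\<eta>. \<eta> \<in> underS r \<delta> \<Longrightarrow> s \<eta> = s' \<eta>"
    and far: "1 / real (Suc n) \<le> \<bar>s \<delta> - y \<delta>\<bar>" "1 / real (Suc n) \<le> \<bar>s' \<delta> - y \<delta>\<bar>"
    and side: "s \<delta> < y \<delta> \<longleftrightarrow> s' \<delta> < y \<delta>"
  shows "approx_cylinder_pos E n \<gamma> s y = approx_cylinder_pos E n \<gamma> s' y"
proof -
  have weight: "weight E n s y \<eta> = weight E n s' y \<eta>" if "\<eta> \<in> Field r" for \<eta>
  proof (cases "\<delta> \<in> underS r \<eta>")
    case True
    then show ?thesis
      using E far weight_zero by simp
  next
    case False
    then show ?thesis
      using underS_linear[OF Field(1) that] agree underS_trans by (intro weight_cong) blast
  qed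
  have "weight E n s y \<eta> * ramp n (s \<eta> - y \<eta>) = weight E n s' y \<eta> * ramp n (s' \<eta> - y \<eta>)"
    if "\<eta> \<in> E" for \<eta>
  proof -
    have "\<eta> \<in> Field r"
      using that Field by blast
    with underS_linear[OF Field(1) this] consider "\<delta> \<in> underS r \<eta>" | "\<eta> = \<delta>" | "\<eta> \<in> underS r \<delta>"
      by blast
    then show ?thesis
    proof cases
      case 1
      then show ?thesis
        using E far weight_zero by simp
    next
      case 2
      then show ?thesis
        using weight[OF Field(1)] ramp_far far side by simp
    next
      case 3
      then show ?thesis
        using weight[OF \<open>\<eta> \<in> Field r\<close>] agree by simp
    qed
  qed
  then show ?thesis
    unfolding approx_cylinder_pos_def weight[OF Field(2)] by (intro arg_cong2[of _ _ _ _ min] refl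
        arg_cong2[of _ _ _ _ "(+)"] sum.cong) auto
qed

lemma approx_cylinder_pos_agree:
  assumes near: "\<And>\<eta>. \<eta> \<in> E \<inter> underS r \<gamma> \<Longrightarrow> \<bar>s \<eta> - y \<eta>\<bar> \<le> 1 / (2 * real (Suc n))"
    and "y \<gamma> \<le> 1"
  shows "approx_cylinder_pos E n \<gamma> s y = y \<gamma>"
proof -
  have "(\<Sum>\<eta>\<in>E \<inter> underS r \<gamma>. weight E n s y \<eta> * ramp n (s \<eta> - y \<eta>)) = 0"
    using near ramp_near by (intro sum.neutral) simp
  then show ?thesis
    using assms weight_one[OF near] by (simp add: approx_cylinder_pos_def)
qed

lemma approx_cylinder_pos_first_diff:
  assumes E: "finite E" "\<delta> \<in> E" "\<delta> \<in> underS r \<gamma>"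
    and near: "\<And>\<eta>. \<eta> \<in> E \<inter> underS r \<delta> \<Longrightarrow> \<bar>s \<eta> - y \<eta>\<bar> \<le> 1 / (2 * real (Suc n))"
    and far: "1 / real (Suc n) \<le> \<bar>s \<delta> - y \<delta>\<bar>"
  shows "approx_cylinder_pos E n \<gamma> s y = (if s \<delta> < y \<delta> then 1 else 0)"
proof -
  let ?f = "\<lambda>\<eta>. weight E n s y \<eta> * ramp n (s \<eta> - y \<eta>)"
  have "?f \<eta> = 0" if "\<eta> \<in> E \<inter> underS r \<gamma> - {\<delta>}" for \<eta>
  proof -
    have "\<eta> \<in> underS r \<delta> \<or> \<delta> \<in> underS r \<eta>"
      using underS_linear[of \<eta> \<delta>] that E(3) underS_Field by blast
    then show ?thesis
      using near[of \<eta>] ramp_near weight_zero[of E \<delta> \<eta> n s y] E far that by auto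
  qed
  then have "sum ?f (E \<inter> underS r \<gamma>) = ?f \<delta>"
    using E sum.mono_neutral_right[of "E \<inter> underS r \<gamma>" "{\<delta>}" ?f] by simp
  moreover have "?f \<delta> = (if s \<delta> < y \<delta> then 1 else 0)"
    using weight_one[OF near] ramp_far[OF far] by simp
  moreover have "weight E n s y \<gamma> = 0"
    using weight_zero E far by simp
  ultimately show ?thesis
    unfolding approx_cylinder_pos_def by simp
qed

section \<open>Profiles of points\<close>

text \<open>
  An enumeration of the coordinates.  In the degenerate case of an empty field it runs through
  a meaningless value, which gets the coefficient \<open>0\<close>.
\<close>

definition idx :: "nat \<Rightarrow> 'a" where
  "idx = from_nat_into (Field r)"

definition coef :: "nat \<Rightarrow> real" where
  "coef m = (if idx m \<in> Field r then (1/2) ^ m else 0)"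

definition initial :: "nat \<Rightarrow> 'a set" where
  "initial n = Field r \<inter> idx ` {..<n}"

lemma idx_surj: "\<gamma> \<in> Field r \<Longrightarrow> \<exists>m. idx m = \<gamma>"
  using countable_Field by (metis idx_def from_nat_into_to_nat_on)

lemma finite_initial: "finite (initial n)" and initial_Field: "initial n \<subseteq> Field r"
  by (auto simp: initial_def)

lemma initial_eventually:
  assumes "\<gamma> \<in> Field r"
  shows "\<forall>\<^sub>F n in sequentially. \<gamma> \<in> initial n"
proof -
  obtain m where m: "idx m = \<gamma>"
    using idx_surj assms by blast
  show ?thesis
    using eventually_gt_at_top[of m] by eventually_elim (use m assms in \<open>auto simp: initial_def\<close>)
qed

text \<open>
  For fixed \<open>x\<close>, the profile \<open>\<lambda>s. profile s x\<close> is the function that represents the point \<open>x\<close>.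
  Summation with the weights \<^const>\<open>coef\<close> merges the cylinder positions for all \<open>\<gamma>\<close> into one
  function on the cube.
\<close>

definition profile :: "('a \<Rightarrow> real) \<Rightarrow> ('a \<Rightarrow> real) \<Rightarrow> real" where
  "profile s x = (\<Sum>m. coef m * cylinder_pos (idx m) s x)"

definition approx_profile :: "nat \<Rightarrow> ('a \<Rightarrow> real) \<Rightarrow> ('a \<Rightarrow> real) \<Rightarrow> real" where
  "approx_profile n s y = (\<Sum>m<n. coef m * approx_cylinder_pos (initial n) n (idx m) s y)"

lemma coef_bound: "\<lbrakk>idx m \<in> Field r \<Longrightarrow> 0 \<le> t \<and> t \<le> 1\<rbrakk> \<Longrightarrow> 0 \<le> coef m * t \<and> coef m * t \<le> (1/2) ^ m"
  by (auto simp: coef_def mult_left_le)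

lemma profile_term_bound:
  "x \<in> lex_cube r \<Longrightarrow> 0 \<le> coef m * cylinder_pos (idx m) s x \<and> coef m * cylinder_pos (idx m) s x \<le> (1/2) ^ m"
  by (intro coef_bound cylinder_pos_range)

lemma summable_half: "summable (\<lambda>m. (1/2 :: real) ^ m)"
  by (simp add: summable_geometric)

lemma summable_profile:
  assumes "x \<in> lex_cube r"
  shows "summable (\<lambda>m. coef m * cylinder_pos (idx m) s x)"
  by (rule summable_comparison_test'[OF summable_half, of 0])
    (use profile_term_bound[OF assms, of _ s] in \<open>simp add: abs_of_nonneg\<close>)

lemma continuous_map_profile:
  assumes s: "s \<in> lex_cube r"
  shows "continuous_map (lex_cube_topology r) euclideanreal (profile s)"
proof -
  have top: "topspace (lex_cube_topology r) = lex_cube r"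
    by (simp add: lex_cube_topology_def)
  have unif: "uniform_limit (lex_cube r) (\<lambda>n x. \<Sum>m<n. coef m * cylinder_pos (idx m) s x) (profile s) sequentially"
    unfolding profile_def
    by (rule Weierstrass_m_test[OF _ summable_half])
      (use profile_term_bound in \<open>simp add: abs_of_nonneg\<close>)
  have cont: "continuous_map (lex_cube_topology r) euclideanreal (\<lambda>x. \<Sum>m<n. coef m * cylinder_pos (idx m) s x)" for n
  proof (intro continuous_map_sum)
    fix m assume "m \<in> {..<n}"
    show "continuous_map (lex_cube_topology r) euclideanreal (\<lambda>x. coef m * cylinder_pos (idx m) s x)"
    proof (cases "idx m \<in> Field r")
      case True
      then show ?thesis
        using continuous_map_cylinder_pos[OF s] by (intro continuous_map_real_mult_left) auto
    qed (simp add: coef_def)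
  qed simp
  have "continuous_map (lex_cube_topology r) Met_TC.mtopology (profile s)"
  proof (rule Met_TC.continuous_map_uniform_limit)
    show "\<forall>\<^sub>F n in sequentially. continuous_map (lex_cube_topology r) Met_TC.mtopology
        (\<lambda>x. \<Sum>m<n. coef m * cylinder_pos (idx m) s x)"
      using cont by simp
    show "\<forall>\<^sub>F n in sequentially. \<forall>x\<in>topspace (lex_cube_topology r). profile s x \<in> UNIV \<and>
        dist (\<Sum>m<n. coef m * cylinder_pos (idx m) s x) (profile s x) < e" if "e > 0" for e
      using uniform_limitD[OF unif that] by (simp add: top)
  qed simp
  then show ?thesis
    by simp
qed

text \<open>
  Take \<open>s = x\<close>.  Every summand is weakly increasing from \<open>x\<close> to \<open>x'\<close>, and the one at the first
  coordinate of disagreement increases strictly.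
\<close>

lemma profile_strict_mono:
  assumes x: "x \<in> lex_cube r" and x': "x' \<in> lex_cube r" and "lex_less r x x'"
  shows "profile x x < profile x x'"
proof -
  obtain \<gamma> where \<gamma>: "first_diff x x' \<gamma>" "x \<gamma> < x' \<gamma>"
    using assms(3) lex_less_iff_first_diff by blast
  then have F: "\<gamma> \<in> Field r"
    by (simp add: first_diff_def)
  have le: "cylinder_pos \<eta> x x \<le> cylinder_pos \<eta> x x'" if \<eta>: "\<eta> \<in> Field r" for \<eta>
  proof -
    have eq: "cylinder_pos \<eta> x x = x \<eta>"
      by (simp add: cylinder_pos_agree)
    show ?thesis
    proof (cases "\<gamma> \<in> underS r \<eta>")
      case True
      then show ?thesis
        using \<gamma> cylinder_pos_first_diff eq lex_cubeD[OF x \<eta>] by simp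
    next
      case False
      then have "\<eta> = \<gamma> \<or> \<eta> \<in> underS r \<gamma>"
        using underS_linear \<eta> F by blast
      then have "cylinder_pos \<eta> x x' = x' \<eta>" "x \<eta> \<le> x' \<eta>"
        using \<gamma> underS_trans cylinder_pos_agree[of \<eta> x x'] unfolding first_diff_def by (blast, auto)
      then show ?thesis
        using eq by simp
    qed
  qed
  have less: "cylinder_pos \<gamma> x x < cylinder_pos \<gamma> x x'"
    using \<gamma> cylinder_pos_agree unfolding first_diff_def by metis
  obtain k where k: "idx k = \<gamma>"
    using idx_surj F by blast
  have "0 < (\<Sum>m. coef m * cylinder_pos (idx m) x x' - coef m * cylinder_pos (idx m) x x)"
  proof (rule suminf_pos2)
    show "summable (\<lambda>m. coef m * cylinder_pos (idx m) x x' - coef m * cylinder_pos (idx m) x x)"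
      using summable_profile x x' by (intro summable_diff)
    show "0 \<le> coef m * cylinder_pos (idx m) x x' - coef m * cylinder_pos (idx m) x x" for m
      using le by (simp add: coef_def)
    show "0 < coef k * cylinder_pos (idx k) x x' - coef k * cylinder_pos (idx k) x x"
      using less F k by (simp add: coef_def)
  qed
  then show ?thesis
    unfolding profile_def
    using suminf_diff[OF summable_profile[OF x', of x] summable_profile[OF x, of x]] by linarith
qed

lemma profile_separates:
  assumes x: "x \<in> lex_cube r" and x': "x' \<in> lex_cube r" and "x \<noteq> x'"
  shows "\<exists>s\<in>lex_cube r. profile s x \<noteq> profile s x'"
proof -
  obtain \<gamma> where "\<gamma> \<in> Field r" "x \<gamma> \<noteq> x' \<gamma>"
    using assms unfolding lex_cube_def by (metis PiE_ext)
  then obtain \<delta> where "first_diff x x' \<delta>"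
    using first_diff_exists by metis
  then have "lex_less r x x' \<or> lex_less r x' x"
    unfolding lex_less_def first_diff_def by (metis linorder_neqE_linordered_idom)
  then show ?thesis
    using profile_strict_mono x x' by (metis less_irrefl)
qed

lemma approx_profile_range:
  assumes "y \<in> lex_cube r"
  shows "0 \<le> approx_profile n s y \<and> approx_profile n s y \<le> 2"
proof -
  have b: "0 \<le> coef m * approx_cylinder_pos (initial n) n (idx m) s y \<and>
      coef m * approx_cylinder_pos (initial n) n (idx m) s y \<le> (1/2) ^ m" for m
    using lex_cubeD[OF assms] by (intro coef_bound approx_cylinder_pos_range) auto
  have "approx_profile n s y \<le> (\<Sum>m<n. (1/2) ^ m)"
    unfolding approx_profile_def using b by (intro sum_mono) auto
  also have "\<dots> \<le> (\<Sum>m. (1/2) ^ m)"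
    by (intro sum_le_suminf summable_half) auto
  also have "\<dots> = 2"
    by (simp add: suminf_geometric)
  finally show ?thesis
    unfolding approx_profile_def using b by (auto intro: sum_nonneg)
qed

lemma continuous_map_approx_profile:
  assumes "\<And>\<eta>. \<eta> \<in> Field r \<Longrightarrow> continuous_map X euclideanreal (\<lambda>p. h p \<eta>)"
  shows "continuous_map X euclideanreal (\<lambda>p. approx_profile n (h p) y)"
  unfolding approx_profile_def using assms initial_Field finite_initial
  by (intro continuous_map_sum continuous_map_real_mult_left continuous_map_approx_cylinder_pos) auto

lemma approx_profile_eq:
  assumes "\<delta> \<in> initial n" and "\<And>\<eta>. \<eta> \<in> underS r \<delta> \<Longrightarrow> s \<eta> = s' \<eta>"
    and "1 / real (Suc n) \<le> \<bar>s \<delta> - y \<delta>\<bar>" "1 / real (Suc n) \<le> \<bar>s' \<delta> - y \<delta>\<bar>"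
    and "s \<delta> < y \<delta> \<longleftrightarrow> s' \<delta> < y \<delta>"
  shows "approx_profile n s y = approx_profile n s' y"
  unfolding approx_profile_def
proof (intro sum.cong refl)
  fix m
  show "coef m * approx_cylinder_pos (initial n) n (idx m) s y = coef m * approx_cylinder_pos (initial n) n (idx m) s' y"
    using approx_cylinder_pos_eq[OF finite_initial assms(1) _ _ initial_Field, of "idx m" s s' n y] assms initial_Field
    by (auto simp: coef_def)
qed

text \<open>
  If \<open>y n\<close> follows \<open>x\<close> closely enough to stay on the plateaus, then for each \<open>s\<close> all factors before
  the first disagreement of \<open>s\<close> and \<open>x\<close> are exact, and those at the disagreement become
  exact as soon as the margin \<open>1 / (n + 1)\<close> is small enough.
\<close>

lemma approx_cylinder_pos_tendsto:
  assumes x: "x \<in> lex_cube r" and \<gamma>: "\<gamma> \<in> Field r"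
    and y: "\<And>n. y n \<in> lex_cube r"
    and near: "\<And>n \<eta>. \<eta> \<in> initial n \<Longrightarrow> \<bar>x \<eta> - y n \<eta>\<bar> \<le> 1 / (2 * real (Suc n))"
  shows "(\<lambda>n. approx_cylinder_pos (initial n) n \<gamma> s (y n)) \<longlonglongrightarrow> cylinder_pos \<gamma> s x"
proof -
  have lim0: "(\<lambda>n. 1 / (2 * real (Suc n))) \<longlonglongrightarrow> 0"
    by real_asymp
  have y_lim: "(\<lambda>n. y n \<eta>) \<longlonglongrightarrow> x \<eta>" if "\<eta> \<in> Field r" for \<eta>
  proof (rule Lim_transform2)
    show "(\<lambda>n. x \<eta>) \<longlonglongrightarrow> x \<eta>" by simp
    show "(\<lambda>n. x \<eta> - y n \<eta>) \<longlonglongrightarrow> 0"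
      by (rule Lim_null_comparison[OF _ lim0])
        (use initial_eventually[OF that] near in \<open>auto elim!: eventually_mono\<close>)
  qed
  have far: "\<forall>\<^sub>F n in sequentially. \<delta> \<in> initial n \<and> 1 / real (Suc n) \<le> \<bar>s \<delta> - y n \<delta>\<bar> \<and>
      (s \<delta> < y n \<delta> \<longleftrightarrow> s \<delta> < x \<delta>)" if \<delta>: "\<delta> \<in> Field r" "s \<delta> \<noteq> x \<delta>" for \<delta>
  proof -
    have lim: "(\<lambda>n. s \<delta> - y n \<delta>) \<longlonglongrightarrow> s \<delta> - x \<delta>"
      by (intro tendsto_intros y_lim \<delta>)
    have "(\<lambda>n. \<bar>s \<delta> - y n \<delta>\<bar> - 1 / real (Suc n)) \<longlonglongrightarrow> \<bar>s \<delta> - x \<delta>\<bar> - 0"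
      by (intro tendsto_diff tendsto_rabs lim) real_asymp
    then have "\<forall>\<^sub>F n in sequentially. 0 < \<bar>s \<delta> - y n \<delta>\<bar> - 1 / real (Suc n)"
      by (rule order_tendstoD) (use \<delta> in simp)
    moreover have "\<forall>\<^sub>F n in sequentially. s \<delta> < y n \<delta> \<longleftrightarrow> s \<delta> < x \<delta>"
    proof (cases "s \<delta> < x \<delta>")
      case True
      then show ?thesis
        using order_tendstoD(1)[OF y_lim[OF \<delta>(1)] True] by (auto elim: eventually_mono)
    next
      case False
      then have "x \<delta> < s \<delta>" using \<delta> by simp
      from order_tendstoD(2)[OF y_lim[OF \<delta>(1)] this] show ?thesis
        by eventually_elim (use False in auto)
    qed
    ultimately show ?thesis
      using initial_eventually[OF \<delta>(1)] by eventually_elim auto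
  qed
  show ?thesis
  proof (cases "\<forall>\<eta>\<in>underS r \<gamma>. s \<eta> = x \<eta>")
    case True
    have "approx_cylinder_pos (initial n) n \<gamma> s (y n) = y n \<gamma>" for n
      using True near lex_cubeD[OF y \<gamma>] by (intro approx_cylinder_pos_agree) auto
    then show ?thesis
      using y_lim[OF \<gamma>] cylinder_pos_agree[OF True] by simp
  next
    case False
    then obtain \<eta> where "\<eta> \<in> underS r \<gamma>" "s \<eta> \<noteq> x \<eta>"
      by blast
    then obtain \<delta> where \<delta>: "first_diff s x \<delta>" "\<delta> \<in> underS r \<gamma>"
      using first_diff_exists underS_Field underS_trans by metis
    then have "\<delta> \<in> Field r" "s \<delta> \<noteq> x \<delta>"
      by (auto simp: first_diff_def)
    from far[OF this] have "\<forall>\<^sub>F n in sequentially. approx_cylinder_pos (initial n) n \<gamma> s (y n) = cylinder_pos \<gamma> s x"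
    proof eventually_elim
      case (elim n)
      then have "approx_cylinder_pos (initial n) n \<gamma> s (y n) = (if s \<delta> < y n \<delta> then 1 else 0)"
        using \<delta> near by (intro approx_cylinder_pos_first_diff finite_initial) (auto simp: first_diff_def)
      then show ?case
        using elim cylinder_pos_first_diff[OF \<delta>] by simp
    qed
    then show ?thesis
      by (rule tendsto_eventually)
  qed
qed

lemma approx_profile_tendsto:
  assumes x: "x \<in> lex_cube r" and y: "\<And>n. y n \<in> lex_cube r"
    and near: "\<And>n \<eta>. \<eta> \<in> initial n \<Longrightarrow> \<bar>x \<eta> - y n \<eta>\<bar> \<le> 1 / (2 * real (Suc n))"
  shows "(\<lambda>n. approx_profile n s (y n)) \<longlonglongrightarrow> profile s x"
proof -
  \<comment> \<open>The finite sums are padded with zeros, so that Tannery's theorem on dominated series applies.\<close>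
  define a where "a m n = (if m < n then coef m * approx_cylinder_pos (initial n) n (idx m) s (y n) else 0)" for m n
  have "(\<lambda>n. a m n) \<longlonglongrightarrow> coef m * cylinder_pos (idx m) s x" for m
  proof (rule Lim_transform_eventually)
    show "\<forall>\<^sub>F n in sequentially. coef m * approx_cylinder_pos (initial n) n (idx m) s (y n) = a m n"
      using eventually_gt_at_top[of m] by eventually_elim (simp add: a_def)
    show "(\<lambda>n. coef m * approx_cylinder_pos (initial n) n (idx m) s (y n)) \<longlonglongrightarrow> coef m * cylinder_pos (idx m) s x"
    proof (cases "idx m \<in> Field r")
      case True
      then show ?thesis
        by (intro tendsto_intros approx_cylinder_pos_tendsto x y near)
    qed (simp add: coef_def)
  qed
  moreover have "norm (a m n) \<le> (1/2) ^ m" for m n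
    using coef_bound[of m "approx_cylinder_pos (initial n) n (idx m) s (y n)"] lex_cubeD[OF y]
      approx_cylinder_pos_range[of "y n" "idx m" "initial n" n s]
    by (auto simp: a_def abs_of_nonneg)
  ultimately have "(\<lambda>n. suminf (\<lambda>m. a m n)) \<longlonglongrightarrow> (\<Sum>m. coef m * cylinder_pos (idx m) s x)"
    using tannerys_theorem[of a "\<lambda>m. coef m * cylinder_pos (idx m) s x" sequentially "\<lambda>m. (1/2) ^ m"]
      summable_half by (simp add: case_prod_unfold)
  moreover have "suminf (\<lambda>m. a m n) = approx_profile n s (y n)" for n
    unfolding approx_profile_def
    by (subst suminf_finite[of "{..<n}"]) (auto simp: a_def)
  ultimately show ?thesis
    by (simp add: profile_def)
qed

text \<open>
  The parameters used at stage \<open>n\<close>.  The mesh is the half-width of the plateau, so that every point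
  of the cube has a grid point on whose plateaus it lies; finiteness is what forces
  accumulation to happen along \<open>n\<close> tending to infinity.
\<close>

definition grid :: "nat \<Rightarrow> ('a \<Rightarrow> real) set" where
  "grid n = (\<lambda>z. \<lambda>\<eta>\<in>Field r. if \<eta> \<in> initial n then z \<eta> else 0) `
     (initial n \<rightarrow>\<^sub>E (\<lambda>j. real j / (2 * real (Suc n))) ` {..2 * Suc n})"

lemma finite_grid: "finite (grid n)"
  unfolding grid_def by (intro finite_imageI finite_PiE finite_initial) auto

lemma grid_subset: "grid n \<subseteq> lex_cube r"
proof
  fix y assume "y \<in> grid n"
  then obtain z where z: "z \<in> initial n \<rightarrow>\<^sub>E (\<lambda>j. real j / (2 * real (Suc n))) ` {..2 * Suc n}"
    "y = (\<lambda>\<eta>\<in>Field r. if \<eta> \<in> initial n then z \<eta> else 0)"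
    unfolding grid_def by blast
  have "z \<eta> \<in> {0..1}" if "\<eta> \<in> initial n" for \<eta>
  proof -
    have "z \<eta> \<in> (\<lambda>j. real j / (2 * real (Suc n))) ` {..2 * Suc n}"
      using z(1) that by (rule PiE_mem)
    then obtain j where "j \<le> 2 * Suc n" "z \<eta> = real j / (2 * real (Suc n))"
      by blast
    moreover from this(1) have "real j \<le> 2 * real (Suc n)"
      by linarith
    ultimately show ?thesis
      by (simp add: divide_le_eq_1_pos)
  qed
  then show "y \<in> lex_cube r"
    unfolding lex_cube_def z(2) by auto
qed

lemma grid_near:
  assumes x: "x \<in> lex_cube r"
  shows "\<exists>y\<in>grid n. \<forall>\<eta>\<in>initial n. \<bar>x \<eta> - y \<eta>\<bar> \<le> 1 / (2 * real (Suc n))"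
proof -
  define N where "N = 2 * real (Suc n)"
  define j where "j \<eta> = nat \<lfloor>N * x \<eta>\<rfloor>" for \<eta>
  have N: "N > 0" by (simp add: N_def)
  have j: "real (j \<eta>) \<le> N * x \<eta> \<and> N * x \<eta> \<le> real (j \<eta>) + 1 \<and> j \<eta> \<le> 2 * Suc n"
    if "\<eta> \<in> Field r" for \<eta>
  proof -
    have "0 \<le> N * x \<eta>" "N * x \<eta> \<le> N"
      using lex_cubeD[OF x that] N by (auto simp: mult_left_le)
    then have "real (j \<eta>) = of_int \<lfloor>N * x \<eta>\<rfloor>"
      by (simp add: j_def)
    then have "real (j \<eta>) \<le> N * x \<eta>" "N * x \<eta> \<le> real (j \<eta>) + 1"
      by linarith+
    moreover have "real (j \<eta>) \<le> N"
      using calculation(1) \<open>N * x \<eta> \<le> N\<close> by linarith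
    then have "real (j \<eta>) \<le> real (2 * Suc n)"
      by (simp add: N_def)
    then have "j \<eta> \<le> 2 * Suc n"
      by (simp only: of_nat_le_iff)
    ultimately show ?thesis
      by blast
  qed
  define z where "z = (\<lambda>\<eta>\<in>initial n. real (j \<eta>) / N)"
  define y where "y = (\<lambda>\<eta>\<in>Field r. if \<eta> \<in> initial n then z \<eta> else 0)"
  have "z \<in> initial n \<rightarrow>\<^sub>E (\<lambda>j. real j / (2 * real (Suc n))) ` {..2 * Suc n}"
    using j initial_Field unfolding z_def N_def by (intro restrict_PiE_iff[THEN iffD2]) blast
  then have "y \<in> grid n"
    unfolding grid_def y_def by blast
  moreover have "\<bar>x \<eta> - y \<eta>\<bar> \<le> 1 / N" if "\<eta> \<in> initial n" for \<eta>
  proof -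
    have \<eta>: "\<eta> \<in> Field r"
      using that initial_Field by blast
    have "N * \<bar>x \<eta> - y \<eta>\<bar> = \<bar>N * x \<eta> - real (j \<eta>)\<bar>"
      using N \<eta> that by (simp add: y_def z_def abs_mult_pos' right_diff_distrib)
    also have "\<dots> \<le> 1"
      using j[OF \<eta>] by linarith
    finally show ?thesis
      using N by (simp add: field_simps)
  qed
  ultimately show ?thesis
    unfolding N_def by blast
qed

end

section \<open>A copy of the cube on a set of reals\<close>

lemma homeomorphic_copy_on_reals:
  fixes f :: "'b \<Rightarrow> real"
  assumes "inj_on f (topspace Y)"
  obtains X :: "real topology" and h where "homeomorphic_map X Y h"
proof -
  define h where "h = inv_into (topspace Y) f"
  define X where "X = pullback_topology (f ` topspace Y) h Y"
  have hf: "h (f y) = y" if "y \<in> topspace Y" for y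
    using assms that by (simp add: h_def)
  have top: "topspace X = f ` topspace Y"
    using hf by (auto simp: X_def topspace_pullback_topology)
  have "continuous_map X Y (id \<circ> h)"
    unfolding X_def by (intro continuous_map_pullback) simp
  moreover have "continuous_map Y Y (h \<circ> f)"
    by (rule continuous_map_eq[of _ _ id]) (simp_all add: hf)
  then have "continuous_map Y X f"
    unfolding X_def by (rule continuous_map_pullback') auto
  ultimately have "homeomorphic_maps X Y h f"
    using hf by (auto simp: homeomorphic_maps_def top)
  then show thesis
    using that homeomorphic_maps_map by blast
qed

context countable_ordinal
begin

abbreviation cube :: "('a \<Rightarrow> real) topology" where
  "cube \<equiv> product_topology (\<lambda>_. top_of_set {0..1}) (Field r)"

lemma topspace_lex_cube_topology: "topspace (lex_cube_topology r) = lex_cube r"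
  by (simp add: lex_cube_topology_def)

lemma topspace_cube: "topspace cube = lex_cube r"
  by (simp add: lex_cube_def)

lemma compact_space_cube: "compact_space cube"
  by (simp add: compact_space_product_topology compact_space_subtopology compactin_euclidean_iff)

lemma metrizable_space_cube: "metrizable_space cube"
  using countable_Field
  by (auto simp: metrizable_space_product_topology metrizable_space_subtopology metrizable_space_euclidean
      intro: countable_subset)

lemma continuous_map_cube_coordinate:
  "\<eta> \<in> Field r \<Longrightarrow> continuous_map cube euclideanreal (\<lambda>x. x \<eta>)"
  using continuous_map_product_projection[of \<eta> "Field r" "\<lambda>_. top_of_set {0..1::real}"]
  by (simp add: continuous_map_in_subtopology)

text \<open>
  A point of the cube is coded by the set of pairs of a coordinate and a rational number that
  lies below its value there, hence by a set of natural numbers, hence by a real number.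
\<close>

lemma inj_lex_cube_real: "\<exists>f :: ('a \<Rightarrow> real) \<Rightarrow> real. inj_on f (lex_cube r)"
proof -
  obtain e :: "nat set \<Rightarrow> real" where e: "inj e"
    using nat_sets_eqpoll_reals unfolding eqpoll_def bij_betw_def by blast
  define code where "code x = {prod_encode (to_nat_on (Field r) \<gamma>, k) |\<gamma> k.
    \<gamma> \<in> Field r \<and> of_rat (from_nat k) < x \<gamma>}" for x :: "'a \<Rightarrow> real"
  have mem: "prod_encode (to_nat_on (Field r) \<gamma>, k) \<in> code x \<longleftrightarrow> of_rat (from_nat k) < x \<gamma>"
    if "\<gamma> \<in> Field r" for x \<gamma> k
    using that inj_on_to_nat_on[OF countable_Field]
    by (auto simp: code_def prod_encode_eq inj_on_eq_iff)
  have le: "x \<gamma> \<le> y \<gamma>" if "code x = code y" and \<gamma>: "\<gamma> \<in> Field r" for x y \<gamma>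
  proof (rule ccontr)
    assume "\<not> x \<gamma> \<le> y \<gamma>"
    then obtain q where "y \<gamma> < of_rat q" "of_rat q < x \<gamma>"
      using of_rat_dense by (meson not_le)
    then show False
      using mem[OF \<gamma>, of "to_nat q" x] mem[OF \<gamma>, of "to_nat q" y] that(1) by simp
  qed
  have "inj_on code (lex_cube r)"
  proof (rule inj_onI)
    fix x y assume "x \<in> lex_cube r" "y \<in> lex_cube r" "code x = code y"
    then show "x = y"
      using le[of x y] le[of y x] unfolding lex_cube_def by (intro PiE_ext) (auto intro: antisym)
  qed
  with e have "inj_on (e \<circ> code) (lex_cube r)"
    by (simp add: comp_inj_on inj_on_subset)
  then show ?thesis
    by blast
qed

end

section \<open>The compactum generated by the approximations\<close>

text \<open>
  The domain of the functions.  It is kept abstract, with \<open>h\<close> naming the coordinates of its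
  points, because it will be a topology on reals.
\<close>

locale lex_cube_model = countable_ordinal r for r :: "'a rel" +
  fixes X :: "'b topology" and h :: "'b \<Rightarrow> 'a \<Rightarrow> real"
  assumes homeo: "homeomorphic_map X cube h"
begin

lemma compact_space_X: "compact_space X" and metrizable_space_X: "metrizable_space X"
  using homeo compact_space_cube metrizable_space_cube homeomorphic_map_imp_homeomorphic_space
    homeomorphic_compact_space homeomorphic_metrizable_space by blast+

lemma h_image: "h ` topspace X = lex_cube r"
  using homeo homeomorphic_imp_surjective_map topspace_cube by metis

lemma h_in: "p \<in> topspace X \<Longrightarrow> h p \<in> lex_cube r"
  using h_image by blast

lemma h_inj: "inj_on h (topspace X)"
  using homeo homeomorphic_imp_injective_map by blast

lemma continuous_map_h: "\<eta> \<in> Field r \<Longrightarrow> continuous_map X euclideanreal (\<lambda>p. h p \<eta>)"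
  using continuous_map_compose[OF homeomorphic_imp_continuous_map[OF homeo] continuous_map_cube_coordinate]
  by (simp add: comp_def)

abbreviation pointwise :: "('b \<Rightarrow> real) topology" where
  "pointwise \<equiv> powertop_real (topspace X)"

text \<open>
  The order topology embeds through the profiles, read along the homeomorphism \<open>h\<close> as functions
  on \<open>X\<close>.
\<close>

definition point :: "('a \<Rightarrow> real) \<Rightarrow> 'b \<Rightarrow> real" where
  "point x = (\<lambda>p\<in>topspace X. profile (h p) x)"

definition approx_point :: "nat \<Rightarrow> ('a \<Rightarrow> real) \<Rightarrow> 'b \<Rightarrow> real" where
  "approx_point n y = (\<lambda>p\<in>topspace X. approx_profile n (h p) y)"

definition approx_points :: "('b \<Rightarrow> real) set" where
  "approx_points = (\<Union>n. approx_point n ` grid n)"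

lemma approx_point_continuous: "continuous_map X euclideanreal (approx_point n y)"
  by (rule continuous_map_eq[OF continuous_map_approx_profile[OF continuous_map_h]])
    (simp_all add: approx_point_def)

lemma approx_point_ext: "approx_point n y \<in> extensional (topspace X)"
  by (simp add: approx_point_def)

lemma approx_points_continuous:
  "approx_points \<subseteq> {f \<in> extensional (topspace X). continuous_map X euclideanreal f}"
  using approx_point_continuous approx_point_ext unfolding approx_points_def by blast

lemma countable_approx_points: "countable approx_points"
  unfolding approx_points_def by (simp add: countable_finite finite_grid)

text \<open>
  The domain is compact and the range is Hausdorff, so continuity and injectivity suffice.
\<close>

lemma embedding_map_point: "embedding_map (lex_cube_topology r) pointwise point"
proof (rule continuous_imp_embedding_map)
  show "continuous_map (lex_cube_topology r) pointwise point"
    unfolding continuous_map_componentwise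
  proof (intro conjI ballI)
    show "point ` topspace (lex_cube_topology r) \<subseteq> extensional (topspace X)"
      by (auto simp: point_def)
    fix p assume "p \<in> topspace X"
    then show "continuous_map (lex_cube_topology r) euclideanreal (\<lambda>x. point x p)"
      using continuous_map_profile[OF h_in] by (simp add: point_def)
  qed
  show "inj_on point (topspace (lex_cube_topology r))"
  proof (rule inj_onI, rule ccontr)
    fix x x'
    assume xx': "x \<in> topspace (lex_cube_topology r)" "x' \<in> topspace (lex_cube_topology r)" "x \<noteq> x'"
      and eq: "point x = point x'"
    have "\<exists>s\<in>lex_cube r. profile s x \<noteq> profile s x'"
      by (rule profile_separates) (use xx' in \<open>simp_all add: topspace_lex_cube_topology\<close>)
    then have "\<exists>s\<in>h ` topspace X. profile s x \<noteq> profile s x'"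
      by (simp only: h_image)
    then obtain p where "p \<in> topspace X" "profile (h p) x \<noteq> profile (h p) x'"
      by (elim bexE imageE) simp
    then show False
      using fun_cong[OF eq, of p] by (simp add: point_def)
  qed
qed (simp_all add: compact_space_lex_cube Hausdorff_space_product_topology)

lemma point_in_closure:
  assumes x: "x \<in> lex_cube r"
  shows "point x \<in> pointwise closure_of approx_points"
proof -
  obtain y where y: "\<And>n. y n \<in> grid n"
    "\<And>n \<eta>. \<eta> \<in> initial n \<Longrightarrow> \<bar>x \<eta> - y n \<eta>\<bar> \<le> 1 / (2 * real (Suc n))"
    using grid_near[OF x] by metis
  have "limitin pointwise (\<lambda>n. approx_point n (y n)) (point x) sequentially"
    unfolding limitin_componentwise
  proof (intro conjI ballI)
    fix p assume "p \<in> topspace X"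
    then show "limitin euclideanreal (\<lambda>n. approx_point n (y n) p) (point x p) sequentially"
      using approx_profile_tendsto[OF x _ y(2), of "h p"] y(1) grid_subset
      by (auto simp: point_def approx_point_def)
  qed (auto simp: point_def approx_point_def)
  moreover have "approx_point n (y n) \<in> approx_points" for n
    using y(1) by (auto simp: approx_points_def)
  ultimately show ?thesis
    unfolding in_closure_of limitin_def
    by (metis (no_types, lifting) eventually_happens sequentially_bot)
qed

lemma compactin_closure: "compactin pointwise (pointwise closure_of approx_points)"
proof (rule closed_compactin)
  show "compactin pointwise (\<Pi>\<^sub>E p\<in>topspace X. {0..2})"
    by (simp add: compactin_PiE)
  show "pointwise closure_of approx_points \<subseteq> (\<Pi>\<^sub>E p\<in>topspace X. {0..2})"
  proof (rule closure_of_minimal)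
    show "approx_points \<subseteq> (\<Pi>\<^sub>E p\<in>topspace X. {0..2})"
      using approx_profile_range grid_subset
      by (fastforce simp: approx_points_def approx_point_def)
    show "closedin pointwise (\<Pi>\<^sub>E p\<in>topspace X. {0..2})"
      by (simp add: closedin_product_topology)
  qed
qed simp

text \<open>
  Near the cluster point the approximating functions take equal values at \<open>p\<close> and \<open>q\<close> by
  \<open>approx_profile_eq\<close>, and the inequality \<open>g p \<noteq> g q\<close> would be an open condition on \<open>g\<close>.
\<close>

lemma cluster_constant:
  assumes cluster: "\<forall>U W N. openin cube U \<and> x \<in> U \<and> openin pointwise W \<and> g \<in> W \<longrightarrow>
      (\<exists>n\<ge>N. \<exists>y\<in>grid n \<inter> U. approx_point n y \<in> W)"
    and x: "x \<in> lex_cube r" and g: "g \<in> topspace pointwise"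
    and p: "p \<in> topspace X" and q: "q \<in> topspace X"
    and \<delta>: "\<delta> \<in> Field r" and e: "0 < e"
    and agree: "\<And>\<eta>. \<eta> \<in> underS r \<delta> \<Longrightarrow> h p \<eta> = h q \<eta>"
    and side: "h p \<delta> \<le> x \<delta> - e \<and> h q \<delta> \<le> x \<delta> - e \<or> x \<delta> + e \<le> h p \<delta> \<and> x \<delta> + e \<le> h q \<delta>"
  shows "g p = g q"
proof (rule ccontr)
  assume neq: "g p \<noteq> g q"
  define W where "W = {f \<in> topspace pointwise. f p - f q \<in> - {0}}"
  define U where "U = {y \<in> topspace cube. y \<delta> \<in> ball (x \<delta>) (e/2)}"
  have "openin pointwise W"
    unfolding W_def using p q
    by (intro openin_continuous_map_preimage[where Y = euclideanreal]
        continuous_map_diff continuous_map_product_projection) auto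
  moreover have "openin cube U"
    unfolding U_def using \<delta>
    by (intro openin_continuous_map_preimage[where Y = euclideanreal] continuous_map_cube_coordinate) auto
  moreover have "g \<in> W" "x \<in> U"
    using g neq x e topspace_cube by (auto simp: W_def U_def)
  moreover obtain m where m: "1 / real (Suc m) < e / 2"
    using e nat_approx_posE by (metis half_gt_zero)
  moreover obtain k where "\<And>n. n \<ge> k \<Longrightarrow> \<delta> \<in> initial n"
    using initial_eventually[OF \<delta>] unfolding eventually_sequentially by blast
  moreover note cluster[rule_format, of U W "max m k"]
  ultimately obtain n y where n: "n \<ge> m" "\<delta> \<in> initial n" and y: "y \<in> U" "approx_point n y \<in> W"
    by (metis IntD2 max.bounded_iff)
  \<comment> \<open>Half of the margin \<open>e\<close> may be lost to the distance of \<open>y\<close> from \<open>x\<close>; the other half exceeds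
    the scale \<open>1 / (n + 1)\<close> of the plateau.\<close>
  have "1 / real (Suc n) \<le> 1 / real (Suc m)"
    using n by (simp add: frac_le)
  with m have small: "1 / real (Suc n) < e / 2"
    by linarith
  have "\<bar>x \<delta> - y \<delta>\<bar> < e / 2"
    using y(1) by (simp add: U_def dist_real_def)
  then have "1 / real (Suc n) \<le> \<bar>h p \<delta> - y \<delta>\<bar>" "1 / real (Suc n) \<le> \<bar>h q \<delta> - y \<delta>\<bar>"
    "h p \<delta> < y \<delta> \<longleftrightarrow> h q \<delta> < y \<delta>"
    using side small by linarith+
  then have "approx_profile n (h p) y = approx_profile n (h q) y"
    by (intro approx_profile_eq[OF n(2) agree])
  with y(2) p q show False
    by (simp add: W_def approx_point_def)
qed

lemma closedin_coordinate:
  assumes "\<eta> \<in> Field r" "closed C"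
  shows "closedin X {p \<in> topspace X. h p \<eta> \<in> C}"
  using assms by (intro closedin_continuous_map_preimage[OF continuous_map_h]) auto

lemma closedin_agree:
  assumes "A \<subseteq> Field r"
  shows "closedin X {p \<in> topspace X. \<forall>\<eta>\<in>A. h p \<eta> = x \<eta>}"
proof -
  have "{p \<in> topspace X. \<forall>\<eta>\<in>A. h p \<eta> = x \<eta>} =
      \<Inter>(insert (topspace X) ((\<lambda>\<eta>. {p \<in> topspace X. h p \<eta> \<in> {x \<eta>}}) ` A))"
    by auto
  moreover have "closedin X \<dots>"
    using assms closedin_coordinate[OF _ closed_singleton] by (intro closedin_Inter) auto
  ultimately show ?thesis
    by simp
qed

text \<open>
  A function in the closure that is not one of the approximations has a cluster parameter \<open>x\<close>.
  It is constant on each set of points that first leave \<open>x\<close> at a given coordinate, on a given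
  side and by at least \<open>1 / (k + 1)\<close>.  These sets are closed, there are countably many
  of them, and together with the point \<open>x\<close> itself they exhaust the space.
\<close>

lemma closure_baire_one: "pointwise closure_of approx_points \<subseteq> baire_one X"
proof
  fix g assume g: "g \<in> pointwise closure_of approx_points"
  then have g_top: "g \<in> topspace pointwise"
    by (simp add: in_closure_of)
  then have g_ext: "g \<in> extensional (topspace X)"
    by (simp add: PiE_def)
  show "g \<in> baire_one X"
  proof (cases "g \<in> approx_points")
    case True
    then have "continuous_map X euclideanreal g"
      using approx_points_continuous by blast
    with g_ext show ?thesis
      unfolding baire_one_def by (auto intro!: exI[of _ "\<lambda>_. g"])
  next
    case False
    have "\<exists>x\<in>topspace cube. \<forall>U W N. openin cube U \<and> x \<in> U \<and> openin pointwise W \<and> g \<in> W \<longrightarrow>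
        (\<exists>n\<ge>N. \<exists>y\<in>grid n \<inter> U. approx_point n y \<in> W)"
    proof (rule cluster_parameter)
      show "t1_space pointwise"
        by (simp add: Hausdorff_imp_t1_space Hausdorff_space_product_topology)
      show "g \<in> pointwise closure_of (\<Union>n. approx_point n ` grid n)" "g \<notin> (\<Union>n. approx_point n ` grid n)"
        using g False by (simp_all add: approx_points_def)
    qed (use compact_space_cube finite_grid grid_subset topspace_cube approx_point_ext in
        \<open>auto simp: PiE_def\<close>)
    then obtain x where "x \<in> topspace cube"
      and cluster: "\<forall>U W N. openin cube U \<and> x \<in> U \<and> openin pointwise W \<and> g \<in> W \<longrightarrow>
        (\<exists>n\<ge>N. \<exists>y\<in>grid n \<inter> U. approx_point n y \<in> W)"
      by (rule bexE)
    then have x: "x \<in> lex_cube r"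
      using topspace_cube by simp
    define left where "left \<delta> k = {p \<in> topspace X. h p \<delta> \<in> {..x \<delta> - 1 / real (Suc k)}} \<inter>
      {p \<in> topspace X. \<forall>\<eta>\<in>underS r \<delta>. h p \<eta> = x \<eta>}" for \<delta> k
    define right where "right \<delta> k = {p \<in> topspace X. h p \<delta> \<in> {x \<delta> + 1 / real (Suc k)..}} \<inter>
      {p \<in> topspace X. \<forall>\<eta>\<in>underS r \<delta>. h p \<eta> = x \<eta>}" for \<delta> k
    define centre where "centre = {p \<in> topspace X. \<forall>\<eta>\<in>Field r. h p \<eta> = x \<eta>}"
    define \<C> where "\<C> = insert centre (\<Union>\<delta>\<in>Field r. range (left \<delta>) \<union> range (right \<delta>))"
    show ?thesis
    proof (rule baire_one_if_constant_on_closed_pieces)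
      show "normal_space X"
        by (simp add: metrizable_imp_normal_space metrizable_space_X)
      show "countable \<C>"
        unfolding \<C>_def using countable_Field by simp
      show "closedin X C" if "C \<in> \<C>" for C
      proof -
        have "underS r \<delta> \<subseteq> Field r" for \<delta>
          using underS_Field by blast
        then have "closedin X centre" "\<And>\<delta> k. \<delta> \<in> Field r \<Longrightarrow> closedin X (left \<delta> k)"
          "\<And>\<delta> k. \<delta> \<in> Field r \<Longrightarrow> closedin X (right \<delta> k)"
          unfolding left_def right_def centre_def
          by (intro closedin_Int closedin_coordinate closedin_agree closed_atMost closed_atLeast; simp)+
        then show ?thesis
          using that by (auto simp: \<C>_def)
      qed
      show "topspace X \<subseteq> \<Union>\<C>"
      proof
        fix p assume p: "p \<in> topspace X"
        show "p \<in> \<Union>\<C>"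
        proof (cases "\<forall>\<eta>\<in>Field r. h p \<eta> = x \<eta>")
          case True
          then show ?thesis
            using p by (auto simp: \<C>_def centre_def)
        next
          case False
          then obtain \<delta> where "first_diff (h p) x \<delta>"
            using first_diff_exists by metis
          then have \<delta>: "\<delta> \<in> Field r" "\<forall>\<eta>\<in>underS r \<delta>. h p \<eta> = x \<eta>" "h p \<delta> \<noteq> x \<delta>"
            by (auto simp: first_diff_def)
          then have "0 < \<bar>h p \<delta> - x \<delta>\<bar>"
            by simp
          then obtain k where "1 / real (Suc k) < \<bar>h p \<delta> - x \<delta>\<bar>"
            using nat_approx_posE by blast
          then have "h p \<delta> \<le> x \<delta> - 1 / real (Suc k) \<or> x \<delta> + 1 / real (Suc k) \<le> h p \<delta>"
            by linarith
          then have "p \<in> left \<delta> k \<or> p \<in> right \<delta> k"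
            using p \<delta> by (auto simp: left_def right_def)
          then show ?thesis
            using \<delta>(1) by (auto simp: \<C>_def)
        qed
      qed
      show "g p = g q" if "C \<in> \<C>" "p \<in> C" "q \<in> C" for C p q
      proof -
        consider "C = centre" | \<delta> k where "\<delta> \<in> Field r" "C = left \<delta> k \<or> C = right \<delta> k"
          using \<open>C \<in> \<C>\<close> unfolding \<C>_def by blast
        then show ?thesis
        proof cases
          case 1
          then have pq: "p \<in> topspace X" "q \<in> topspace X" "\<forall>\<eta>\<in>Field r. h p \<eta> = h q \<eta>"
            using that by (auto simp: centre_def)
          then have "h p = h q"
            using PiE_ext[OF h_in[OF pq(1), unfolded lex_cube_def] h_in[OF pq(2), unfolded lex_cube_def]]
            by blast
          then show ?thesis
            using pq h_inj by (simp add: inj_on_eq_iff)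
        next
          case (2 \<delta> k)
          show ?thesis
          proof (rule cluster_constant[OF cluster x g_top])
            show "\<delta> \<in> Field r" by fact
            show "0 < 1 / real (Suc k)" by simp
          qed (use 2(2) that(2,3) in \<open>auto simp: left_def right_def\<close>)
        qed
      qed
    qed (fact g_ext)
  qed
qed

end

lemma class_RK0_imp_rosenthal_compactum: "class_RK0 K \<Longrightarrow> rosenthal_compactum K"
  unfolding class_RK0_def rosenthal_compactum_def using compact_metrizable_imp_polish by blast

theorem proposition5:
  fixes r :: "'a rel"
  assumes "Well_order r" and "countable (Field r)"
  shows "rosenthal_compactum (lex_cube_topology r) \<and>
    (\<exists>L :: (real \<Rightarrow> real) topology. rosenthal_compactum L \<and> class_RK0 L \<and>
       (\<exists>S \<subseteq> topspace L. lex_cube_topology r homeomorphic_space subtopology L S))"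
proof -
  interpret countable_ordinal r
    using assms by unfold_locales
  obtain f :: "('a \<Rightarrow> real) \<Rightarrow> real" where "inj_on f (topspace cube)"
    using inj_lex_cube_real topspace_cube by metis
  then obtain X :: "real topology" and h where "homeomorphic_map X cube h"
    by (rule homeomorphic_copy_on_reals)
  then interpret lex_cube_model r X h
    by unfold_locales
  define F where "F = pointwise closure_of approx_points"
  define L where "L = subtopology pointwise F"
  define S where "S = point ` lex_cube r"
  have F: "compactin pointwise F" "F \<subseteq> baire_one X"
    using compactin_closure closure_baire_one by (simp_all add: F_def)
  have "S \<subseteq> F"
    using point_in_closure by (auto simp: S_def F_def)
  have homeo: "lex_cube_topology r homeomorphic_space subtopology pointwise S"
    using embedding_map_imp_homeomorphic_space[OF embedding_map_point] by (simp add: S_def topspace_lex_cube_topology)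
  have "compactin pointwise S"
    using homeo compact_space_lex_cube embedding_map_point unfolding S_def
    by (metis compact_space_def embedding_map_def homeomorphic_imp_continuous_map
        continuous_map_in_subtopology image_compactin topspace_lex_cube_topology)
  with \<open>S \<subseteq> F\<close> F(2) homeo compact_space_lex_cube
  have "rosenthal_compactum (lex_cube_topology r)"
    unfolding rosenthal_compactum_def
    using compact_metrizable_imp_polish[OF compact_space_X metrizable_space_X] by blast
  moreover have "class_RK0 L"
    unfolding class_RK0_def
  proof (intro conjI exI)
    show "compact_space L"
      using F(1) by (simp add: L_def compact_space_subtopology)
    show "F = pointwise closure_of approx_points"
      by (fact F_def)
    show "L homeomorphic_space subtopology pointwise F"
      by (simp add: L_def homeomorphic_space_refl)
  qed (fact compact_space_X metrizable_space_X F countable_approx_points approx_points_continuous)+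
  moreover have "subtopology L S = subtopology pointwise S"
    using \<open>S \<subseteq> F\<close> by (simp add: L_def subtopology_subtopology Int_absorb1)
  then have "lex_cube_topology r homeomorphic_space subtopology L S"
    using homeo by simp
  moreover have "S \<subseteq> topspace L"
    using \<open>S \<subseteq> F\<close> compactin_subset_topspace[OF F(1)] by (auto simp: L_def)
  ultimately show ?thesis
    using class_RK0_imp_rosenthal_compactum by blast
qed

end
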